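(* Let $T$ be a compact $\mathbb{R}$-tree with finite upper-box dimension, $\overline{\dim}\, T < \infty$. Then, for any $\delta > 0$, there exists a continuous function $f : [0,1] \to \mathbb{R}$ of finite $(\overline{\dim}\, T + \delta)$-variation such that $T = T_f$ (up to isometry). In particular, up to a reparametrization, $f$ can be taken to be $\frac{1}{\overline{\dim}\, T+\delta}$-Hölder continuous.
   Context: $\overline{\dim}$ denotes the upper-box dimension. An $\mathbb{R}$-tree is a connected geodesic metric space containing no subset homeomorphic to the circle. For a continuous $f:[0,1]\to\mathbb{R}$, put $d_f(x,y) := f(x)+f(y) - 2\sup_{\gamma : x\mapsto y}\inf_{t\in[0,1]} f(\gamma(t))$, the supremum being over continuous paths $\gamma$ in $[0,1]$ from $x$ to $y$. This is a pseudo-distance, and $T_f := [0,1]/\{d_f = 0\}$ with the induced distance $d_f$ is an $\mathbb{R}$-tree. The (true) $p$-variation of $f$ is $\|f\|_{p\text{-var}} := \left[\sup_D \sum_{t_k\in D} |f(t_k)-f(t_{k-1})|^p\right]^{1/p}$, the supremum being over all finite partitions $D$ of $[0,1]$. *)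

theory Defs
  imports "HOL-Analysis.Analysis"
begin

definition geodesic_set :: "'a::metric_space set \<Rightarrow> bool" where
  "geodesic_set T \<longleftrightarrow>
     (\<forall>x\<in>T. \<forall>y\<in>T. \<exists>\<gamma>::real \<Rightarrow> 'a.
        \<gamma> 0 = x \<and> \<gamma> (dist x y) = y \<and> \<gamma> ` {0..dist x y} \<subseteq> T \<and>
        (\<forall>s\<in>{0..dist x y}. \<forall>t\<in>{0..dist x y}. dist (\<gamma> s) (\<gamma> t) = \<bar>s - t\<bar>))"

text \<open>Nonemptiness is stated because the library's \<open>connected\<close> holds of the empty set.\<close>

definition real_tree :: "'a::metric_space set \<Rightarrow> bool" where
  "real_tree T \<longleftrightarrow> T \<noteq> {} \<and> connected T \<and> geodesic_set T \<and>
     \<not> (\<exists>S\<subseteq>T. S homeomorphic sphere (0::complex) 1)"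

text \<open>The least number of balls of radius \<open>\<epsilon>\<close>, centred in \<open>T\<close>, that cover \<open>T\<close>.
  It is meaningful only if such a finite cover exists.\<close>

definition covering_number :: "'a::metric_space set \<Rightarrow> real \<Rightarrow> nat" where
  "covering_number T \<epsilon> =
     (LEAST n. \<exists>C. finite C \<and> C \<subseteq> T \<and> card C = n \<and> T \<subseteq> (\<Union>x\<in>C. ball x \<epsilon>))"

definition upper_box_dim :: "'a::metric_space set \<Rightarrow> ereal" where
  "upper_box_dim T =
     (if totally_bounded T
      then Limsup (at_right 0) (\<lambda>\<epsilon>. ereal (ln (real (covering_number T \<epsilon>)) / ln (1 / \<epsilon>)))
      else \<infinity>)"

definition tree_pdist :: "(real \<Rightarrow> real) \<Rightarrow> real \<Rightarrow> real \<Rightarrow> real" where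
  "tree_pdist f x y =
     f x + f y - 2 * (SUP \<gamma> \<in> {\<gamma>. path \<gamma> \<and> path_image \<gamma> \<subseteq> {0..1} \<and>
                                   pathstart \<gamma> = x \<and> pathfinish \<gamma> = y}.
                        INF t\<in>{0..1}. f (\<gamma> t))"

definition tree_rel :: "(real \<Rightarrow> real) \<Rightarrow> (real \<times> real) set" where
  "tree_rel f = {(x, y). x \<in> {0..1} \<and> y \<in> {0..1} \<and> tree_pdist f x y = 0}"

definition tree_of :: "(real \<Rightarrow> real) \<Rightarrow> real set set" where
  "tree_of f = {0..1} // tree_rel f"

text \<open>For continuous \<open>f\<close>, \<open>tree_pdist f\<close> is a pseudo-distance on the unit interval, so it is
  constant on \<open>A \<times> B\<close> for \<open>A, B \<in> tree_of f\<close>.\<close>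

definition tree_dist :: "(real \<Rightarrow> real) \<Rightarrow> real set \<Rightarrow> real set \<Rightarrow> real" where
  "tree_dist f A B = the_elem (\<Union>x\<in>A. \<Union>y\<in>B. {tree_pdist f x y})"

definition isometric_to_tree_of :: "'a::metric_space set \<Rightarrow> (real \<Rightarrow> real) \<Rightarrow> bool" where
  "isometric_to_tree_of T f \<longleftrightarrow>
     (\<exists>h. bij_betw h T (tree_of f) \<and>
          (\<forall>x\<in>T. \<forall>y\<in>T. tree_dist f (h x) (h y) = dist x y))"

text \<open>\<open>(n, t)\<close> stands for the partition \<open>0 = t 0 < \<dots> < t n = 1\<close>; the values of \<open>t\<close> beyond
  \<open>n\<close> are irrelevant.\<close>

definition partitions01 :: "(nat \<times> (nat \<Rightarrow> real)) set" where
  "partitions01 = {(n, t). t 0 = 0 \<and> t n = 1 \<and> (\<forall>k<n. t k < t (Suc k))}"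

definition p_variation_sum :: "(real \<Rightarrow> real) \<Rightarrow> real \<Rightarrow> ennreal" where
  "p_variation_sum f p =
     (SUP (n, t) \<in> partitions01. ennreal (\<Sum>k<n. \<bar>f (t (Suc k)) - f (t k)\<bar> powr p))"

definition p_variation :: "(real \<Rightarrow> real) \<Rightarrow> real \<Rightarrow> ennreal" where
  "p_variation f p =
     (if p_variation_sum f p = \<infinity> then \<infinity>
      else ennreal (enn2real (p_variation_sum f p) powr (1 / p)))"

definition holder01 :: "real \<Rightarrow> (real \<Rightarrow> real) \<Rightarrow> bool" where
  "holder01 \<alpha> f \<longleftrightarrow>
     (\<exists>C. \<forall>s\<in>{0..1}. \<forall>t\<in>{0..1}. \<bar>f s - f t\<bar> \<le> C * \<bar>s - t\<bar> powr \<alpha>)"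

definition reparametrization01 :: "(real \<Rightarrow> real) \<Rightarrow> bool" where
  "reparametrization01 \<phi> \<longleftrightarrow>
     continuous_on {0..1} \<phi> \<and> strict_mono_on {0..1} \<phi> \<and> \<phi> ` {0..1} = {0..1}"

end

theory Submission
  imports Defs "HOL-Real_Asymp.Real_Asymp"
begin

text \<open>Root the tree at \<open>\<rho>\<close> and choose points greedily, each farthest from the subtree spanned by its
  predecessors. The distances (\<open>gap\<close>) decrease and the first \<open>n + 1\<close> points are \<open>gap n\<close>-separated, so the
  box dimension makes \<open>\<Sum>n. gap n powr p\<close> finite. Explore the subtrees by contour tours, inserting
  the \<open>n\<close>-th new branch as an excursion of duration \<open>2 * gap n powr p\<close>. These tours are
  \<open>1/p\<close>-Hoelder with a common constant: up to twice \<open>gap n\<close>, distances are seen in the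
  \<open>n\<close>-th subtree, which is explored at speed at most \<open>gap (n - 1) powr (1 - p)\<close>. A cluster point of the
  tours visits the whole tree, and its height above \<open>\<rho>\<close> is the function sought; being Hoelder
  already, it needs no reparametrization.\<close>

section \<open>Trees without circles are ultrametric\<close>

text \<open>The obstacle is that the total length of the finite subtrees may be unbounded, so tours
  at unit speed have no common modulus of continuity on a bounded time interval. Shortening the
  duration of a branch to the power \<open>p\<close> of its length keeps the total time finite, at
  the price of speeds \<open>gap n powr (1 - p)\<close> that grow with \<open>n\<close> when
  \<open>p > 1\<close>. The greedy order resolves this conflict: what is added after a subtree is
  invisible at scales above its gap, and the speed within a subtree is governed by its latest
  branch. A tree with more than one point has dimension at least 1, which gives
  \<open>p \<ge> 1\<close>; a one-point tree is treated apart. The exploration sees the tree only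
  through heights and Gromov products at the root. Since the tours are controlled uniformly, a
  pointwise cluster point is good enough.\<close>

lemma arc_o_linepath:
  fixes g :: "real \<Rightarrow> 'a::t2_space"
  assumes "continuous_on (closed_segment a b) g" "inj_on g (closed_segment a b)" "a \<noteq> b"
  shows "arc (g \<circ> linepath a b)"
    and "path_image (g \<circ> linepath a b) = g ` closed_segment a b"
    and "pathstart (g \<circ> linepath a b) = g a"
    and "pathfinish (g \<circ> linepath a b) = g b"
proof -
  have "arc (linepath a b)" using assms by (simp add: arc_linepath)
  then have "inj_on (linepath a b) {0..1}" by (rule arc_imp_inj_on)
  moreover have "linepath a b ` {0..1} = closed_segment a b"
    using path_image_linepath[of a b] by (simp add: path_image_def)
  ultimately have "inj_on (g \<circ> linepath a b) {0..1}"
    using assms(2) by (simp add: comp_inj_on)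
  moreover have "path (g \<circ> linepath a b)"
    using assms(1) by (intro path_continuous_image) auto
  ultimately show "arc (g \<circ> linepath a b)" by (simp add: arc_def)
qed (auto simp: path_image_compose pathstart_compose pathfinish_compose)

text \<open>If \<open>g1\<close> leaves the image of \<open>g2\<close> at time \<open>c\<close>, the
  maximal time interval around \<open>c\<close> spent off that image has both ends on it. The piece
  of \<open>g1\<close> over this interval and the piece of \<open>g2\<close> between the same two
  points meet only there, so together they form a circle in \<open>T\<close>.\<close>

lemma arc_image_subset:
  fixes g1 g2 :: "real \<Rightarrow> 'a::t2_space"
  assumes nocirc: "\<not> (\<exists>S\<subseteq>T. S homeomorphic sphere (0::complex) 1)"
    and arcs: "arc g1" "arc g2"
    and sub: "path_image g1 \<subseteq> T" "path_image g2 \<subseteq> T"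
    and ends: "pathstart g1 = pathstart g2" "pathfinish g1 = pathfinish g2"
  shows "path_image g1 \<subseteq> path_image g2"
proof (rule ccontr)
  assume "\<not> ?thesis"
  then obtain c where c: "c \<in> {0..1}" "g1 c \<notin> path_image g2"
    unfolding path_image_def[of g1] by blast
  have cont: "continuous_on {0..1} g1" and cont2: "continuous_on {0..1} g2"
    using arcs by (auto simp: arc_def path_def)
  have inj: "inj_on g1 {0..1}" and inj2: "inj_on g2 {0..1}" using arcs by (auto simp: arc_def)
  have closed2: "closed (path_image g2)"
    using arcs(2) by (simp add: arc_imp_path compact_imp_closed compact_path_image)
  define A where "A = {0..1} \<inter> g1 -` path_image g2"
  have clA: "closed A" unfolding A_def
    by (rule continuous_closed_preimage[OF cont _ closed2]) auto
  have 01: "0 \<in> A" "1 \<in> A"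
    using ends pathstart_in_path_image[of g2] pathfinish_in_path_image[of g2]
    by (auto simp: A_def pathstart_def pathfinish_def)
  have "compact (A \<inter> {0..c})" "compact (A \<inter> {c..1})"
    using clA by (auto intro: closed_Int_compact)
  moreover have "A \<inter> {0..c} \<noteq> {}" "A \<inter> {c..1} \<noteq> {}" using 01 c by auto
  ultimately obtain a b where
    a: "a \<in> A" "0 \<le> a" "a \<le> c" "\<And>t. t \<in> A \<Longrightarrow> 0 \<le> t \<Longrightarrow> t \<le> c \<Longrightarrow> t \<le> a" and
    b: "b \<in> A" "c \<le> b" "b \<le> 1" "\<And>t. t \<in> A \<Longrightarrow> c \<le> t \<Longrightarrow> t \<le> 1 \<Longrightarrow> b \<le> t"
    using compact_attains_sup[of "A \<inter> {0..c}"] compact_attains_inf[of "A \<inter> {c..1}"]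
    by (metis Int_iff atLeastAtMost_iff)
  have "a \<noteq> c" "b \<noteq> c" using a(1) b(1) c by (auto simp: A_def)
  with a b have ab: "0 \<le> a" "a < c" "c < b" "b \<le> 1" by auto
  obtain a' b' where a': "a' \<in> {0..1}" "g1 a = g2 a'" and b': "b' \<in> {0..1}" "g1 b = g2 b'"
    using a(1) b(1) by (auto simp: A_def path_image_def)
  have "g1 a \<noteq> g1 b" using ab inj_onD[OF inj, of a b] by auto
  then have ne: "b' \<noteq> a'" using a' b' by auto
  have seg1: "closed_segment a b \<subseteq> {0..1}" using ab by (auto simp: closed_segment_eq_real_ivl)
  have seg2: "closed_segment b' a' \<subseteq> {0..1}" using a' b' by (auto simp: closed_segment_eq_real_ivl)
  have P: "continuous_on (closed_segment a b) g1" "inj_on g1 (closed_segment a b)" "a \<noteq> b"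
    using ab continuous_on_subset[OF cont seg1] inj_on_subset[OF inj seg1] by auto
  have Q: "continuous_on (closed_segment b' a') g2" "inj_on g2 (closed_segment b' a')" "b' \<noteq> a'"
    using ne continuous_on_subset[OF cont2 seg2] inj_on_subset[OF inj2 seg2] by auto
  note P' = arc_o_linepath[OF P] and Q' = arc_o_linepath[OF Q]
  let ?P = "g1 \<circ> linepath a b" and ?Q = "g2 \<circ> linepath b' a'"
  have "path_image ?P \<inter> path_image ?Q \<subseteq> {pathstart ?P, pathstart ?Q}"
  proof
    fix w assume "w \<in> path_image ?P \<inter> path_image ?Q"
    then obtain t where t: "t \<in> {a..b}" "w = g1 t" and "w \<in> path_image g2"
      using P'(2) Q'(2) seg2 ab by (auto simp: path_image_def closed_segment_eq_real_ivl)
    then have "t \<in> A" using ab by (auto simp: A_def)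
    then have "t = a \<or> t = b"
      using a(4)[of t] b(4)[of t] t ab by force
    then show "w \<in> {pathstart ?P, pathstart ?Q}"
      using t P'(3) Q'(3) b' by auto
  qed
  then have "simple_path (?P +++ ?Q)"
    using P' Q' a' b' by (intro simple_path_join_loop) auto
  moreover have "pathfinish (?P +++ ?Q) = pathstart (?P +++ ?Q)"
    using P' Q' a' b' by auto
  ultimately have "path_image (?P +++ ?Q) homeomorphic sphere (0::complex) 1"
    by (rule homeomorphic_simple_path_image_circle) auto
  moreover have "path_image (?P +++ ?Q) \<subseteq> T"
  proof -
    have "path_image ?P \<subseteq> T" "path_image ?Q \<subseteq> T"
      using sub image_mono[OF seg1, of g1] image_mono[OF seg2, of g2] P'(2) Q'(2)
      by (auto simp: path_image_def[of g1] path_image_def[of g2])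
    then show ?thesis by (meson subset_trans path_image_join_subset Un_least)
  qed
  ultimately show False using nocirc by blast
qed

section \<open>Geodesics from a common point\<close>

definition isometric_on :: "real set \<Rightarrow> (real \<Rightarrow> 'a::metric_space) \<Rightarrow> bool" where
  "isometric_on S \<gamma> \<longleftrightarrow> (\<forall>s\<in>S. \<forall>t\<in>S. dist (\<gamma> s) (\<gamma> t) = \<bar>s - t\<bar>)"

lemma isometric_on_subset: "isometric_on S \<gamma> \<Longrightarrow> R \<subseteq> S \<Longrightarrow> isometric_on R \<gamma>"
  by (auto simp: isometric_on_def)

lemma isometric_on_dist: "isometric_on S \<gamma> \<Longrightarrow> s \<in> S \<Longrightarrow> t \<in> S \<Longrightarrow> dist (\<gamma> s) (\<gamma> t) = \<bar>s - t\<bar>"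
  by (auto simp: isometric_on_def)

lemma isometric_on_continuous: "isometric_on S \<gamma> \<Longrightarrow> continuous_on S \<gamma>"
  by (force simp: continuous_on_iff isometric_on_def dist_real_def)

lemma isometric_on_inj: "isometric_on S \<gamma> \<Longrightarrow> inj_on \<gamma> S"
  by (force simp: inj_on_def isometric_on_def)

lemma isometric_arc:
  assumes "isometric_on (closed_segment a b) \<gamma>" "a \<noteq> b"
  shows "arc (\<gamma> \<circ> linepath a b)"
    and "path_image (\<gamma> \<circ> linepath a b) = \<gamma> ` closed_segment a b"
    and "pathstart (\<gamma> \<circ> linepath a b) = \<gamma> a"
    and "pathfinish (\<gamma> \<circ> linepath a b) = \<gamma> b"
  using arc_o_linepath[OF isometric_on_continuous[OF assms(1)] isometric_on_inj[OF assms(1)] assms(2)]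
  by auto

text \<open>By uniqueness of arcs \<open>\<gamma> r\<close> lies on \<open>\<eta>\<close>; both
  curves are parametrized by the distance from their common start, so it lies there at the same
  parameter.\<close>

lemma geodesics_agree_below:
  fixes \<gamma> \<eta> :: "real \<Rightarrow> 'a::metric_space"
  assumes nocirc: "\<not> (\<exists>S\<subseteq>T. S homeomorphic sphere (0::complex) 1)"
    and iso: "isometric_on {0..s} \<gamma>" "isometric_on {0..s} \<eta>"
    and sub: "\<gamma> ` {0..s} \<subseteq> T" "\<eta> ` {0..s} \<subseteq> T"
    and eq: "\<gamma> 0 = \<eta> 0" "\<gamma> s = \<eta> s" and r: "0 \<le> r" "r \<le> s"
  shows "\<gamma> r = \<eta> r"
proof (cases "s = 0")
  case True
  then show ?thesis using r eq by auto
next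
  case False
  then have s: "0 < s" using r by simp
  then have seg: "closed_segment 0 s = {0..s}" by (simp add: closed_segment_eq_real_ivl)
  note G = isometric_arc[of 0 s \<gamma>, unfolded seg, OF iso(1) False[symmetric]]
   and E = isometric_arc[of 0 s \<eta>, unfolded seg, OF iso(2) False[symmetric]]
  have "\<gamma> ` {0..s} \<subseteq> \<eta> ` {0..s}"
    using arc_image_subset[OF nocirc G(1) E(1)] G(2-) E(2-) sub eq by auto
  moreover have "\<gamma> r \<in> \<gamma> ` {0..s}" using r by auto
  ultimately obtain r' where r': "r' \<in> {0..s}" "\<gamma> r = \<eta> r'" by blast
  have "r = dist (\<gamma> r) (\<gamma> 0)"
    using r s isometric_on_dist[OF iso(1), of r 0] by auto
  also have "\<dots> = dist (\<eta> r') (\<eta> 0)" using r' eq by simp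
  also have "\<dots> = r'"
    using r' s isometric_on_dist[OF iso(2), of r' 0] by auto
  finally show ?thesis using r' by simp
qed

text \<open>\<open>m\<close> is the last parameter at which the geodesics agree. Beyond it they are
  disjoint, since a common point has one distance from the start and thus one parameter. The two
  legs joined at the branch point form an arc, which the geodesic between the end points has to
  contain; so it passes through the branch point and the lengths of the legs add up.\<close>

lemma tripod:
  fixes T :: "'a::metric_space set"
  assumes tree: "real_tree T"
    and \<gamma>: "isometric_on {0..a} \<gamma>" "\<gamma> ` {0..a} \<subseteq> T" "0 \<le> a"
    and \<eta>: "isometric_on {0..b} \<eta>" "\<eta> ` {0..b} \<subseteq> T" "0 \<le> b"
    and root: "\<gamma> 0 = \<eta> 0"
  obtains m where "0 \<le> m" "m \<le> a" "m \<le> b" "dist (\<gamma> a) (\<eta> b) = a + b - 2 * m"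
    "\<And>r. 0 \<le> r \<Longrightarrow> r \<le> m \<Longrightarrow> \<gamma> r = \<eta> r"
proof -
  have nocirc: "\<not> (\<exists>S\<subseteq>T. S homeomorphic sphere (0::complex) 1)"
    and geo: "geodesic_set T" using tree by (auto simp: real_tree_def)
  define A where "A = {t \<in> {0..min a b}. dist (\<gamma> t) (\<eta> t) = 0}"
  have "continuous_on {0..min a b} (\<lambda>t. dist (\<gamma> t) (\<eta> t))"
    using isometric_on_subset[OF \<gamma>(1), of "{0..min a b}"] isometric_on_subset[OF \<eta>(1), of "{0..min a b}"]
    by (intro continuous_on_dist isometric_on_continuous) auto
  then have "closed A"
    unfolding A_def by (intro continuous_closed_preimage_constant) auto
  moreover have "bounded A" by (rule bounded_subset[of "{0..min a b}"]) (auto simp: A_def)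
  ultimately have "compact A" by (simp add: compact_eq_bounded_closed)
  moreover have "0 \<in> A" using root \<gamma>(3) \<eta>(3) by (auto simp: A_def)
  ultimately obtain m where mA: "m \<in> A" and mmax: "\<And>t. t \<in> A \<Longrightarrow> t \<le> m"
    using compact_attains_sup[of A] by blast
  have m: "0 \<le> m" "m \<le> a" "m \<le> b" "\<gamma> m = \<eta> m" using mA by (auto simp: A_def)
  have agree: "\<gamma> r = \<eta> r" if "0 \<le> r" "r \<le> s" "s \<le> a" "s \<le> b" "\<gamma> s = \<eta> s" for r s
  proof (rule geodesics_agree_below[OF nocirc _ _ _ _ root that(5,1,2)])
    have "{0..s} \<subseteq> {0..a}" "{0..s} \<subseteq> {0..b}" using that by auto
    then show "isometric_on {0..s} \<gamma>" "isometric_on {0..s} \<eta>" "\<gamma> ` {0..s} \<subseteq> T" "\<eta> ` {0..s} \<subseteq> T"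
      using \<gamma> \<eta> isometric_on_subset by blast+
  qed
  have meet: "s = t \<and> t \<le> m" if st: "s \<in> {0..a}" "t \<in> {0..b}" "\<gamma> s = \<eta> t" for s t
  proof -
    have "s = dist (\<gamma> s) (\<gamma> 0)" using isometric_on_dist[OF \<gamma>(1), of s 0] st by auto
    also have "\<dots> = t" using isometric_on_dist[OF \<eta>(1), of t 0] st root by auto
    finally have "s = t" .
    moreover from this have "t \<in> A" using st by (auto simp: A_def)
    ultimately show ?thesis using mmax by auto
  qed
  have ma: "dist (\<gamma> a) (\<gamma> m) = a - m" using isometric_on_dist[OF \<gamma>(1), of a m] m by auto
  have mb: "dist (\<eta> m) (\<eta> b) = b - m" using isometric_on_dist[OF \<eta>(1), of m b] m by auto
  have "dist (\<gamma> a) (\<eta> b) = a + b - 2 * m"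
  \<comment> \<open>A leg of length zero is no arc and is treated apart.\<close>
  proof (cases "m = a \<or> m = b")
    case True
    then show ?thesis using m ma mb by auto
  next
    case False
    then have lt: "m < a" "m < b" using m by auto
    have seg: "closed_segment a m = {m..a}" "closed_segment m b = {m..b}"
      using lt by (auto simp: closed_segment_eq_real_ivl)
    have "isometric_on {m..a} \<gamma>" "isometric_on {m..b} \<eta>"
      using m by (auto intro: isometric_on_subset[OF \<gamma>(1)] isometric_on_subset[OF \<eta>(1)])
    then have G: "arc (\<gamma> \<circ> linepath a m)" "path_image (\<gamma> \<circ> linepath a m) = \<gamma> ` {m..a}"
        "pathstart (\<gamma> \<circ> linepath a m) = \<gamma> a" "pathfinish (\<gamma> \<circ> linepath a m) = \<gamma> m"
      and E: "arc (\<eta> \<circ> linepath m b)" "path_image (\<eta> \<circ> linepath m b) = \<eta> ` {m..b}"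
        "pathstart (\<eta> \<circ> linepath m b) = \<eta> m" "pathfinish (\<eta> \<circ> linepath m b) = \<eta> b"
      using isometric_arc[of a m \<gamma>] isometric_arc[of m b \<eta>] lt seg by auto
    let ?J = "(\<gamma> \<circ> linepath a m) +++ (\<eta> \<circ> linepath m b)"
    have "\<gamma> ` {m..a} \<inter> \<eta> ` {m..b} \<subseteq> {\<eta> m}"
    proof
      fix w assume "w \<in> \<gamma> ` {m..a} \<inter> \<eta> ` {m..b}"
      then obtain s t where "s \<in> {m..a}" "t \<in> {m..b}" "w = \<gamma> s" "w = \<eta> t" by auto
      moreover from this have "s = t \<and> t \<le> m" using meet[of s t] m by auto
      ultimately show "w \<in> {\<eta> m}" by auto
    qed
    then have J: "arc ?J" using G E m by (intro arc_join) auto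
    have Jim: "path_image ?J = \<gamma> ` {m..a} \<union> \<eta> ` {m..b}"
      using G E m by (simp add: path_image_join)
    have inT: "\<gamma> a \<in> T" "\<eta> b \<in> T" using \<gamma>(2,3) \<eta>(2,3) by auto
    define D where "D = dist (\<gamma> a) (\<eta> b)"
    obtain \<zeta> where \<zeta>: "\<zeta> 0 = \<gamma> a" "\<zeta> D = \<eta> b" "\<zeta> ` {0..D} \<subseteq> T" "isometric_on {0..D} \<zeta>"
      using geo inT unfolding geodesic_set_def isometric_on_def D_def by blast
    have "D \<noteq> 0" using arc_distinct_ends[OF J] G E by (auto simp: D_def)
    then have D: "0 < D" by (simp add: D_def)
    have segD: "closed_segment 0 D = {0..D}" using D by (simp add: closed_segment_eq_real_ivl)
    note Z = isometric_arc[of 0 D \<zeta>, unfolded segD, OF \<zeta>(4) \<open>D \<noteq> 0\<close>[symmetric]]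
    have "path_image ?J \<subseteq> path_image (\<zeta> \<circ> linepath 0 D)"
    proof (rule arc_image_subset[OF nocirc J Z(1)])
      have "{m..a} \<subseteq> {0..a}" "{m..b} \<subseteq> {0..b}" using m by auto
      then show "path_image ?J \<subseteq> T" unfolding Jim using \<gamma>(2) \<eta>(2) by blast
    qed (use Z \<zeta> G E in auto)
    moreover have "\<gamma> m \<in> path_image ?J" using Jim lt by auto
    ultimately obtain r where r: "r \<in> {0..D}" "\<gamma> m = \<zeta> r" using Z(2) by auto
    have "dist (\<gamma> a) (\<gamma> m) + dist (\<gamma> m) (\<eta> b) = D"
      using isometric_on_dist[OF \<zeta>(4), of 0 r] isometric_on_dist[OF \<zeta>(4), of r D] r \<zeta>(1,2) by auto
    then show ?thesis using ma mb m(4) by (simp add: D_def)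
  qed
  then show thesis using that[of m] m agree[of _ m] by auto
qed

text \<open>In a tree rooted at \<open>\<rho>\<close> this is the height of the meet of \<open>x\<close> and \<open>y\<close>.\<close>

definition gromov :: "'a::metric_space \<Rightarrow> 'a \<Rightarrow> 'a \<Rightarrow> real" where
  "gromov \<rho> x y = (dist \<rho> x + dist \<rho> y - dist x y) / 2"

text \<open>Up to the smaller of the two meets, the geodesics to \<open>x\<close> and to
  \<open>z\<close> both follow the one to \<open>y\<close>. They share a point at that height, and
  the triangle inequality through it bounds \<open>dist x z\<close>.\<close>

lemma real_tree_gromov_ultrametric:
  fixes T :: "'a::metric_space set"
  assumes tree: "real_tree T" and T: "\<rho> \<in> T" "x \<in> T" "y \<in> T" "z \<in> T"
  shows "min (gromov \<rho> x y) (gromov \<rho> y z) \<le> gromov \<rho> x z"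
proof -
  have "\<exists>\<gamma>. \<gamma> 0 = \<rho> \<and> \<gamma> (dist \<rho> w) = w \<and> \<gamma> ` {0..dist \<rho> w} \<subseteq> T \<and> isometric_on {0..dist \<rho> w} \<gamma>"
    if "w \<in> T" for w
    using tree T(1) that unfolding real_tree_def geodesic_set_def isometric_on_def by blast
  then obtain \<gamma> where \<gamma>: "\<And>w. w \<in> T \<Longrightarrow> \<gamma> w 0 = \<rho>" "\<And>w. w \<in> T \<Longrightarrow> \<gamma> w (dist \<rho> w) = w"
     "\<And>w. w \<in> T \<Longrightarrow> \<gamma> w ` {0..dist \<rho> w} \<subseteq> T" "\<And>w. w \<in> T \<Longrightarrow> isometric_on {0..dist \<rho> w} (\<gamma> w)"
    by metis
  have meet: "0 \<le> gromov \<rho> v w \<and> gromov \<rho> v w \<le> dist \<rho> v \<and> gromov \<rho> v w \<le> dist \<rho> w \<and>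
     (\<forall>r. 0 \<le> r \<longrightarrow> r \<le> gromov \<rho> v w \<longrightarrow> \<gamma> v r = \<gamma> w r)" if vw: "v \<in> T" "w \<in> T" for v w
  proof -
    obtain m where "0 \<le> m" "m \<le> dist \<rho> v" "m \<le> dist \<rho> w"
        "dist (\<gamma> v (dist \<rho> v)) (\<gamma> w (dist \<rho> w)) = dist \<rho> v + dist \<rho> w - 2 * m"
        "\<And>r. 0 \<le> r \<Longrightarrow> r \<le> m \<Longrightarrow> \<gamma> v r = \<gamma> w r"
      using \<gamma> vw by (elim tripod[OF tree, rotated 7]) auto
    moreover from this have "gromov \<rho> v w = m" using \<gamma>(2) vw by (simp add: gromov_def)
    ultimately show ?thesis by auto
  qed
  define s where "s = min (gromov \<rho> x y) (gromov \<rho> y z)"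
  have s: "0 \<le> s" "s \<le> dist \<rho> x" "s \<le> dist \<rho> z" "\<gamma> x s = \<gamma> z s"
    using meet[of x y] meet[of y z] T by (auto simp: s_def)
  have "dist x (\<gamma> x s) = dist \<rho> x - s" "dist z (\<gamma> z s) = dist \<rho> z - s"
    using isometric_on_dist[OF \<gamma>(4), of x "dist \<rho> x" s] isometric_on_dist[OF \<gamma>(4), of z "dist \<rho> z" s]
      \<gamma>(2) T s by auto
  then have "dist x z \<le> dist \<rho> x + dist \<rho> z - 2 * s"
    using dist_triangle3[of x z "\<gamma> x s"] s by (simp add: dist_commute)
  then show ?thesis by (simp add: gromov_def s_def field_simps)
qed

lemma geodesic_set_prefix:
  fixes T :: "'a::metric_space set"
  assumes "geodesic_set T" "\<rho> \<in> T" "x \<in> T" "0 \<le> s" "s \<le> dist \<rho> x"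
  obtains z where "z \<in> T" "dist \<rho> z = s" "dist z x = dist \<rho> x - s"
proof -
  obtain \<gamma> where \<gamma>: "\<gamma> 0 = \<rho>" "\<gamma> (dist \<rho> x) = x" "\<gamma> ` {0..dist \<rho> x} \<subseteq> T"
      "isometric_on {0..dist \<rho> x} \<gamma>"
    using assms unfolding geodesic_set_def isometric_on_def by blast
  moreover from this have "\<gamma> s \<in> T" using assms(4,5) by auto
  ultimately show ?thesis
    using that[of "\<gamma> s"] assms(4,5) isometric_on_dist[OF \<gamma>(4), of 0 s]
      isometric_on_dist[OF \<gamma>(4), of s "dist \<rho> x"] by auto
qed

section \<open>Elementary facts on Gromov products\<close>

lemma gromov_commute: "gromov \<rho> x y = gromov \<rho> y x"
  by (simp add: gromov_def dist_commute)

lemma gromov_nonneg: "0 \<le> gromov \<rho> x y"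
  using dist_triangle2[of x y \<rho>] by (simp add: gromov_def dist_commute)

lemma gromov_le: "gromov \<rho> x y \<le> dist \<rho> x" "gromov \<rho> x y \<le> dist \<rho> y"
  using dist_triangle[of \<rho> y x] dist_triangle[of \<rho> x y]
  by (simp_all add: gromov_def dist_commute)

lemma gromov_self [simp]: "gromov \<rho> x x = dist \<rho> x"
  by (simp add: gromov_def)

lemma gromov_root [simp]: "gromov \<rho> x \<rho> = 0" "gromov \<rho> \<rho> x = 0"
  by (simp_all add: gromov_def dist_commute)

lemma dist_gromov: "dist x y = dist \<rho> x + dist \<rho> y - 2 * gromov \<rho> x y"
  by (simp add: gromov_def field_simps)

lemma tendsto_gromov [tendsto_intros]:
  "(f \<longlongrightarrow> x) F \<Longrightarrow> (g \<longlongrightarrow> y) F \<Longrightarrow> ((\<lambda>t. gromov \<rho> (f t) (g t)) \<longlongrightarrow> gromov \<rho> x y) F"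
  unfolding gromov_def by (intro tendsto_intros) auto

lemma continuous_on_gromov [continuous_intros]:
  "continuous_on S f \<Longrightarrow> continuous_on S g \<Longrightarrow> continuous_on S (\<lambda>t. gromov \<rho> (f t) (g t))"
  unfolding gromov_def by (intro continuous_intros) auto

section \<open>Rooted trees and greedy exploration\<close>

text \<open>What the exploration uses of a real tree: the 0-hyperbolic inequality for meets as seen
  from the root, and the points on the geodesics that start there. The absence of circles enters
  only through that inequality.\<close>

locale rooted_tree =
  fixes T :: "'a::metric_space set" and \<rho> :: 'a
  assumes compact: "compact T" and root: "\<rho> \<in> T"
    and ultrametric: "\<And>x y z. x \<in> T \<Longrightarrow> y \<in> T \<Longrightarrow> z \<in> T \<Longrightarrow>
      min (gromov \<rho> x y) (gromov \<rho> y z) \<le> gromov \<rho> x z"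
    and prefix_exists: "\<And>x s. x \<in> T \<Longrightarrow> 0 \<le> s \<Longrightarrow> s \<le> dist \<rho> x \<Longrightarrow>
      \<exists>z\<in>T. dist \<rho> z = s \<and> dist z x = dist \<rho> x - s"
begin

text \<open>The ancestor of \<open>x\<close> at height \<open>s\<close>, with \<open>s\<close> cut
  off at the height of \<open>x\<close>. For \<open>x\<close> in \<open>T\<close> and
  \<open>0 \<le> s\<close> the choice is unambiguous: by the ultrametric inequality two candidates
  meet at their common height and hence coincide.\<close>

definition pre :: "'a \<Rightarrow> real \<Rightarrow> 'a" where
  "pre x s = (SOME z. z \<in> T \<and> dist \<rho> z = min s (dist \<rho> x) \<and> gromov \<rho> z x = min s (dist \<rho> x))"

context
  fixes x and s :: real assumes x: "x \<in> T" and s: "0 \<le> s"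
begin

lemma pre_properties:
  "pre x s \<in> T \<and> dist \<rho> (pre x s) = min s (dist \<rho> x) \<and> gromov \<rho> (pre x s) x = min s (dist \<rho> x)"
proof -
  obtain z where "z \<in> T" "dist \<rho> z = min s (dist \<rho> x)" "dist z x = dist \<rho> x - min s (dist \<rho> x)"
    using prefix_exists[OF x, of "min s (dist \<rho> x)"] s by auto
  then have "z \<in> T \<and> dist \<rho> z = min s (dist \<rho> x) \<and> gromov \<rho> z x = min s (dist \<rho> x)"
    by (auto simp: gromov_def)
  then show ?thesis unfolding pre_def by (rule someI)
qed

lemma pre_in: "pre x s \<in> T" and height_pre: "dist \<rho> (pre x s) = min s (dist \<rho> x)"
  using pre_properties by auto

text \<open>Among the three meets of \<open>pre x s\<close>, \<open>x\<close> and \<open>y\<close>,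
  the smallest occurs at least twice; one of the three is the height of \<open>pre x s\<close>
  itself.\<close>

lemma gromov_pre:
  assumes y: "y \<in> T"
  shows "gromov \<rho> (pre x s) y = min s (gromov \<rho> x y)"
proof -
  note p = pre_properties
  have "min (gromov \<rho> (pre x s) x) (gromov \<rho> x y) \<le> gromov \<rho> (pre x s) y"
    using p x y by (intro ultrametric) auto
  moreover have "min (gromov \<rho> x (pre x s)) (gromov \<rho> (pre x s) y) \<le> gromov \<rho> x y"
    using p x y by (intro ultrametric) auto
  moreover have "gromov \<rho> (pre x s) y \<le> min s (dist \<rho> x)"
    using p gromov_le(1)[of \<rho> "pre x s" y] by simp
  ultimately show ?thesis
    using p gromov_le(1)[of \<rho> x y] by (auto simp: gromov_commute[of \<rho> x "pre x s"] min_def split: if_splits)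
qed

lemma dist_pre: "dist (pre x s) x = dist \<rho> x - min s (dist \<rho> x)"
  using pre_properties by (simp add: gromov_def)

end

lemma eq_if_gromov:
  assumes "gromov \<rho> x y = dist \<rho> x" "gromov \<rho> x y = dist \<rho> y"
  shows "x = y"
  using dist_gromov[of x y \<rho>] assms by simp

lemma pre_eqI:
  assumes "x \<in> T" "y \<in> T" "0 \<le> s" "s \<le> gromov \<rho> x y"
  shows "pre x s = pre y s"
  using assms gromov_le[of \<rho> x y]
  by (intro eq_if_gromov)
    (auto simp: gromov_pre pre_in height_pre gromov_commute[of \<rho> x "pre y s"] gromov_commute[of \<rho> y x])

lemma pre_pre:
  assumes "x \<in> T" "0 \<le> s" "0 \<le> t"
  shows "pre (pre x s) t = pre x (min s t)"
  using assms
  by (intro eq_if_gromov)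
    (auto simp: gromov_pre pre_in height_pre gromov_commute[of \<rho> x "pre x _"] min_def)

lemma pre_self:
  assumes "x \<in> T" "dist \<rho> x \<le> s"
  shows "pre x s = x"
proof -
  have "0 \<le> s" using assms(2) zero_le_dist[of \<rho> x] by linarith
  then show ?thesis using dist_pre[OF assms(1), of s] assms(2) by simp
qed

lemma dist_pre_pre:
  assumes "x \<in> T" "0 \<le> s" "0 \<le> t"
  shows "dist (pre x s) (pre x t) \<le> \<bar>s - t\<bar>"
  using assms dist_gromov[of "pre x s" "pre x t" \<rho>]
  by (auto simp: gromov_pre pre_in height_pre gromov_commute[of \<rho> x "pre x _"] min_def split: if_splits)

text \<open>Greedy exploration: \<open>hh n z\<close> is the height at which \<open>z\<close> branches off the subtree spanned by
  the root and the first \<open>n\<close> chosen points, and \<open>far\<close> picks a point farthest from that subtree.\<close>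

definition far :: "('a \<Rightarrow> real) \<Rightarrow> 'a" where
  "far h = (SOME x. x \<in> T \<and> (\<forall>z\<in>T. dist \<rho> z - h z \<le> dist \<rho> x - h x))"

primrec hh :: "nat \<Rightarrow> 'a \<Rightarrow> real" where
  "hh 0 = (\<lambda>z. 0)"
| "hh (Suc n) = (\<lambda>z. max (hh n z) (gromov \<rho> z (far (hh n))))"

definition tip :: "nat \<Rightarrow> 'a" where "tip n = far (hh n)"
definition gap :: "nat \<Rightarrow> real" where "gap n = dist \<rho> (tip n) - hh n (tip n)"
text \<open>The nearest-point retraction onto the \<open>n\<close>-th subtree. That subtree is never
  formed as a set: for \<open>z\<close> in \<open>T\<close>, membership is expressed by
  \<open>hh n z = dist \<rho> z\<close>.\<close>

definition proj :: "nat \<Rightarrow> 'a \<Rightarrow> 'a" where "proj n z = pre z (hh n z)"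

lemma hh_Suc: "hh (Suc n) z = max (hh n z) (gromov \<rho> z (tip n))"
  by (simp add: tip_def)

declare hh.simps(2) [simp del]

lemma continuous_on_hh: "continuous_on S (hh n)"
proof (induction n)
  case (Suc n)
  have "hh (Suc n) = (\<lambda>z. max (hh n z) (gromov \<rho> z (tip n)))" by (auto simp: hh_Suc)
  then show ?case using Suc by (auto intro!: continuous_intros)
qed auto

lemma tip_properties: "tip n \<in> T \<and> (\<forall>z\<in>T. dist \<rho> z - hh n z \<le> gap n)"
proof -
  have "continuous_on T (\<lambda>z. dist \<rho> z - hh n z)"
    by (intro continuous_intros continuous_on_hh)
  then obtain x where "x \<in> T" "\<forall>z\<in>T. dist \<rho> z - hh n z \<le> dist \<rho> x - hh n x"
    using continuous_attains_sup[OF compact, of "\<lambda>z. dist \<rho> z - hh n z"] root by blast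
  then have "x \<in> T \<and> (\<forall>z\<in>T. dist \<rho> z - hh n z \<le> dist \<rho> x - hh n x)" by blast
  then show ?thesis unfolding gap_def tip_def far_def by (rule someI)
qed

lemma tip_in: "tip n \<in> T" and gap_max: "z \<in> T \<Longrightarrow> dist \<rho> z - hh n z \<le> gap n"
  using tip_properties by auto

lemma hh_nonneg: "0 \<le> hh n z"
  by (induction n) (auto simp: hh_Suc)

lemma hh_le: "hh n z \<le> dist \<rho> z"
  by (induction n) (auto simp: hh_Suc gromov_le)

lemma hh_mono: "m \<le> n \<Longrightarrow> hh m z \<le> hh n z"
  by (induction n rule: dec_induct) (auto simp: hh_Suc)

lemma gap_nonneg: "0 \<le> gap n"
  by (simp add: gap_def hh_le)

text \<open>\<open>tip n\<close> was already a candidate when \<open>tip m\<close> was chosen, and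
  its excess over the smaller subtree is no less.\<close>

lemma gap_antimono: "m \<le> n \<Longrightarrow> gap n \<le> gap m"
  using gap_max[OF tip_in, of n m] hh_mono[of m n "tip n"] by (simp add: gap_def)

lemma hh_pre:
  assumes "x \<in> T" "0 \<le> s"
  shows "hh n (pre x s) = min s (hh n x)"
  using assms by (induction n) (auto simp: hh_Suc gromov_pre tip_in)

lemma hh_tip: "i < n \<Longrightarrow> hh n (tip i) = dist \<rho> (tip i)"
  using hh_mono[of "Suc i" n "tip i"] hh_le[of n "tip i"] gromov_le(1)[of \<rho> "tip i" "tip i"]
  by (auto simp: hh_Suc)

text \<open>The last stretch of the branch to \<open>tip j\<close>, of length \<open>gap j\<close>,
  lies outside the subtree that contains \<open>tip i\<close>, so a geodesic between the two tips
  runs through all of it.\<close>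

lemma gap_separated:
  assumes "i < j"
  shows "gap j \<le> dist (tip i) (tip j)"
proof -
  have "gromov \<rho> (tip j) (tip i) \<le> hh (Suc i) (tip j)" by (simp add: hh_Suc)
  also have "\<dots> \<le> hh j (tip j)" using assms by (intro hh_mono) auto
  finally have "gap j \<le> dist \<rho> (tip j) - gromov \<rho> (tip i) (tip j)"
    by (simp add: gap_def gromov_commute)
  then show ?thesis
    using dist_gromov[of "tip i" "tip j" \<rho>] gromov_le(1)[of \<rho> "tip i" "tip j"] by simp
qed

lemma proj_in: "z \<in> T \<Longrightarrow> proj n z \<in> T"
  by (simp add: proj_def pre_in hh_nonneg)

lemma dist_proj: "z \<in> T \<Longrightarrow> dist (proj n z) z \<le> gap n"
  using dist_pre[OF _ hh_nonneg, of z n z] gap_max[of z n] hh_le[of n z] by (simp add: proj_def)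

lemma hh_proj:
  assumes "z \<in> T" "m \<le> n"
  shows "hh m (proj n z) = hh m z"
  using assms hh_mono[of m n z] by (simp add: proj_def hh_pre hh_nonneg)

lemma height_proj: "z \<in> T \<Longrightarrow> dist \<rho> (proj n z) = hh n z"
  using hh_le[of n z] by (simp add: proj_def height_pre hh_nonneg)

lemma proj_proj:
  assumes "z \<in> T" "m \<le> n"
  shows "proj m (proj n z) = proj m z"
  using assms hh_mono[of m n z] hh_proj[OF assms]
  by (simp add: proj_def[of m] proj_def[of n] pre_pre hh_nonneg min_absorb2)

lemma proj_eq_self: "z \<in> T \<Longrightarrow> hh n z = dist \<rho> z \<Longrightarrow> proj n z = z"
  by (simp add: proj_def pre_self)

text \<open>The ancestor of \<open>z\<close> at the height of the meet is also an ancestor of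
  \<open>y\<close> and thus belongs to the subtree. Computing its \<open>hh n\<close> along both
  branches gives the bound.\<close>

lemma gromov_le_hh:
  assumes "y \<in> T" "z \<in> T" "hh n y = dist \<rho> y"
  shows "gromov \<rho> y z \<le> hh n z"
proof -
  have "min (gromov \<rho> y z) (hh n y) = hh n (pre y (gromov \<rho> y z))"
    using assms by (simp add: hh_pre gromov_nonneg)
  also have "\<dots> = hh n (pre z (gromov \<rho> y z))"
    using assms by (simp add: pre_eqI[of y z] gromov_nonneg)
  also have "\<dots> = min (gromov \<rho> y z) (hh n z)"
    using assms by (simp add: hh_pre gromov_nonneg)
  finally show ?thesis using assms(3) gromov_le(1)[of \<rho> y z] by auto
qed

end

section \<open>Contour tours\<close>

context rooted_tree begin

lemma proj_dist_le:
  assumes "x \<in> T" "y \<in> T"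
  shows "dist x y \<le> 2 * gap n + dist (proj n x) (proj n y)"
  using dist_triangle[of x y "proj n x"] dist_triangle[of "proj n x" y "proj n y"]
    dist_proj[OF assms(1), of n] dist_proj[OF assms(2), of n] by (simp add: dist_commute)

text \<open>In \<open>tour_Suc\<close> this makes the new branch invisible from points of the old
  subtree.\<close>

lemma gromov_proj:
  assumes "y \<in> T" "z \<in> T" "hh n y = dist \<rho> y"
  shows "gromov \<rho> y (proj n z) = gromov \<rho> y z"
  using gromov_le_hh[OF assms] assms
  by (simp add: proj_def gromov_commute[of \<rho> y "pre z _"] gromov_pre hh_nonneg gromov_commute[of \<rho> z y])

end

text \<open>Except at corners, exactly one of the two moves at a time, with unit speed: the tent
  during the excursion, the clock outside it.\<close>

lemma tent_clock_contract:
  fixes a \<sigma> :: real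
  assumes "0 \<le> \<sigma>"
  defines "c \<equiv> \<lambda>t. min t a + max 0 (t - a - 2 * \<sigma>)" and "r \<equiv> \<lambda>t. max 0 (\<sigma> - \<bar>t - a - \<sigma>\<bar>)"
  shows "\<bar>c u - c v\<bar> + \<bar>r u - r v\<bar> \<le> \<bar>u - v\<bar>"
  using assms(1) unfolding c_def r_def by (auto simp: min_def max_def abs_if)

text \<open>The third clause says that the branch to tip \<open>K\<close> is run through at speed at most
  \<open>gap K powr (1 - p)\<close>, so that exploring it takes time \<open>2 * gap K powr p\<close>. Tours are defined on
  all reals only to spare the boundary cases.\<close>

definition (in rooted_tree) tour :: "real \<Rightarrow> nat \<Rightarrow> (real \<Rightarrow> 'a) \<Rightarrow> bool" where
  "tour p n g \<longleftrightarrow>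
     (\<forall>t. g t \<in> T \<and> hh n (g t) = dist \<rho> (g t)) \<and>
     (\<forall>s u t. s \<le> u \<longrightarrow> u \<le> t \<longrightarrow> gromov \<rho> (g s) (g t) \<le> dist \<rho> (g u)) \<and>
     (\<forall>K<n. \<forall>u v. gap K powr (p - 1) * dist (proj (Suc K) (g u)) (proj (Suc K) (g v)) \<le> \<bar>u - v\<bar>) \<and>
     (\<forall>z\<in>T. hh n z = dist \<rho> z \<longrightarrow> (\<exists>t\<in>{0..\<Sum>i<n. 2 * gap i powr p}. g t = z))"

context rooted_tree begin

lemma tour_0: "tour p 0 (\<lambda>_. \<rho>)"
  by (auto simp: tour_def root)

text \<open>The branch to tip \<open>n\<close> is inserted at a time \<open>a\<close> at which the old tour visits its base point:
  \<open>c\<close> is the clock of the old tour, stopped at \<open>a\<close> during the excursion, and \<open>r\<close> is the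
  tent-shaped progress along the branch.\<close>

lemma tour_Suc:
  assumes g: "tour p n g" and p: "1 \<le> p"
  shows "\<exists>g'. tour p (Suc n) g'"
proof -
  have gT: "g t \<in> T" and gh: "hh n (g t) = dist \<rho> (g t)" for t
    using g by (auto simp: tour_def)
  have gc: "s \<le> u \<Longrightarrow> u \<le> t \<Longrightarrow> gromov \<rho> (g s) (g t) \<le> dist \<rho> (g u)" for s u t
    using g by (auto simp: tour_def)
  have gl: "K < n \<Longrightarrow> gap K powr (p - 1) * dist (proj (Suc K) (g u)) (proj (Suc K) (g v)) \<le> \<bar>u - v\<bar>" for K u v
    using g by (auto simp: tour_def)
  define \<tau> where "\<tau> = (\<Sum>i<n. 2 * gap i powr p)"
  have gs: "z \<in> T \<Longrightarrow> hh n z = dist \<rho> z \<Longrightarrow> \<exists>t\<in>{0..\<tau>}. g t = z" for z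
    using g by (auto simp: tour_def \<tau>_def)
  define x where "x = tip n"
  define h where "h = hh n x"
  \<comment> \<open>\<open>\<sigma>\<close> is the time for one way along the branch,
    \<open>\<kappa>\<close> the speed and \<open>w\<close> the reciprocal speed. If
    \<open>gap n = 0\<close>, all three are 0 because \<open>0 powr x = 0\<close>; hence
    \<open>w * \<kappa>\<close> is bounded by 1, not equal to it.\<close>
  define \<sigma> where "\<sigma> = gap n powr p"
  define \<kappa> where "\<kappa> = gap n powr (1 - p)"
  define w where "w = gap n powr (p - 1)"
  have x: "x \<in> T" "dist \<rho> x = h + gap n" by (auto simp: x_def h_def tip_in gap_def)
  have h0: "0 \<le> h" by (simp add: h_def hh_nonneg)
  have pos: "0 \<le> \<sigma>" "0 \<le> \<kappa>" "0 \<le> w" by (auto simp: \<sigma>_def \<kappa>_def w_def)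
  have \<kappa>\<sigma>: "\<kappa> * \<sigma> = gap n"
    using gap_nonneg[of n] by (auto simp: \<kappa>_def \<sigma>_def simp flip: powr_add)
  have w\<kappa>: "w * \<kappa> \<le> 1" by (auto simp: \<kappa>_def w_def simp flip: powr_add)
  have "proj n x \<in> T" "hh n (proj n x) = dist \<rho> (proj n x)"
    using x by (auto simp: proj_in hh_proj height_proj)
  then obtain a where a: "a \<in> {0..\<tau>}" "g a = pre x h"
    using gs[of "proj n x"] unfolding proj_def h_def by blast
  define c where "c = (\<lambda>t. min t a + max 0 (t - a - 2 * \<sigma>))"
  define r where "r = (\<lambda>t. max 0 (\<sigma> - \<bar>t - a - \<sigma>\<bar>))"
  have contract: "\<bar>c u - c v\<bar> + \<bar>r u - r v\<bar> \<le> \<bar>u - v\<bar>" for u v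
    unfolding c_def r_def by (rule tent_clock_contract[OF pos(1)])
  have cmono: "u \<le> v \<Longrightarrow> c u \<le> c v" for u v using pos by (auto simp: c_def)
  have r0: "c t \<noteq> a \<Longrightarrow> r t = 0" for t using pos by (auto simp: c_def r_def min_def max_def split: if_splits)
  have rconc: "s \<le> u \<Longrightarrow> u \<le> t \<Longrightarrow> min (r s) (r t) \<le> r u" for s u t
    using pos by (auto simp: r_def min_def max_def abs_if)
  have rle: "0 \<le> r t" "r t \<le> \<sigma>" for t using pos by (auto simp: r_def)
  have \<kappa>r: "0 \<le> \<kappa> * r t" "\<kappa> * r t \<le> gap n" for t
    using rle[of t] pos \<kappa>\<sigma> mult_left_mono[of "r t" \<sigma> \<kappa>] by auto
  define g' where "g' = (\<lambda>t. if c t = a then pre x (h + \<kappa> * r t) else g (c t))"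
  have g'1: "c t = a \<Longrightarrow> g' t = pre x (h + \<kappa> * r t)" and g'2: "c t \<noteq> a \<Longrightarrow> g' t = g (c t)" for t
    by (auto simp: g'_def)
  have g'T: "g' t \<in> T" for t using gT x h0 \<kappa>r[of t] by (simp add: g'_def pre_in)
  have g'proj: "proj n (g' t) = g (c t)" for t
  proof (cases "c t = a")
    case True
    then show ?thesis using x h0 \<kappa>r[of t] a
      by (simp add: g'1 proj_def hh_pre h_def[symmetric] pre_pre min_absorb2)
  next
    case False
    then show ?thesis using gT gh by (simp add: g'2 proj_eq_self)
  qed
  have g'h: "dist \<rho> (g' t) = dist \<rho> (g (c t)) + \<kappa> * r t" for t
  proof (cases "c t = a")
    case True
    then show ?thesis using x h0 \<kappa>r[of t] a gap_nonneg[of n]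
      by (simp add: g'1 height_pre min_absorb1)
  next
    case False
    then show ?thesis by (simp add: g'2 r0)
  qed
  have g'hh: "hh (Suc n) (g' t) = dist \<rho> (g' t)" for t
  proof (cases "c t = a")
    case True
    then show ?thesis using x h0 \<kappa>r[of t]
      by (simp add: g'1 height_pre hh_pre x_def hh_tip)
  next
    case False
    then show ?thesis using hh_mono[of n "Suc n" "g (c t)"] hh_le[of "Suc n" "g (c t)"] gh
      by (simp add: g'2 order_antisym)
  qed
  have contour: "gromov \<rho> (g' s) (g' t) \<le> dist \<rho> (g' u)" if su: "s \<le> u" "u \<le> t" for s u t
  proof -
    have cs: "c s \<le> c u" "c u \<le> c t" using cmono su by auto
    have below: "gromov \<rho> (g (c s)) (g (c t)) \<le> dist \<rho> (g' u)"
      using gc[OF cs] g'h[of u] \<kappa>r[of u] by linarith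
    \<comment> \<open>If one end lies off the excursion, its meet with the other end does not see
      the new branch, and the old contour inequality applies at the clock times. Otherwise all three
      times lie in the excursion, where the tent has no interior dip.\<close>
    consider "c s \<noteq> a" | "c t \<noteq> a" | "c s = a" "c t = a" by blast
    then show ?thesis
    proof cases
      case 1
      then have "gromov \<rho> (g' s) (g' t) = gromov \<rho> (g (c s)) (g (c t))"
        using gromov_proj[OF gT g'T gh, of "c s" t] by (simp add: g'2 g'proj)
      then show ?thesis using below by simp
    next
      case 2
      then have "gromov \<rho> (g' t) (g' s) = gromov \<rho> (g (c t)) (g (c s))"
        using gromov_proj[OF gT g'T gh, of "c t" s] by (simp add: g'2 g'proj)
      then show ?thesis using below by (simp add: gromov_commute)
    next
      case 3
      then have "c u = a" using cs by simp
      have "gromov \<rho> (g' s) (g' t) \<le> min (dist \<rho> (g' s)) (dist \<rho> (g' t))"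
        using gromov_le[of \<rho> "g' s" "g' t"] by simp
      also have "\<dots> = dist \<rho> (g a) + \<kappa> * min (r s) (r t)"
        using 3 pos by (simp add: g'h min_mult_distrib_left)
      also have "\<dots> \<le> dist \<rho> (g' u)"
        using \<open>c u = a\<close> mult_left_mono[OF rconc[OF su] pos(2)] by (simp add: g'h)
      finally show ?thesis .
    qed
  qed
  have step: "dist (g' u) (g' v) \<le> dist (g (c u)) (g (c v)) + \<kappa> * \<bar>r u - r v\<bar>" for u v
  proof -
    have anchor: "dist (g' t) (g a) \<le> \<kappa> * r t" if "c t = a" for t
      using dist_pre_pre[OF x(1), of "h + \<kappa> * r t" h] h0 \<kappa>r[of t] a that by (simp add: g'1)
    consider "c u \<noteq> a" "c v \<noteq> a" | "c u = a" "c v \<noteq> a" | "c u \<noteq> a" "c v = a" | "c u = a" "c v = a" by blast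
    then show ?thesis
    proof cases
      case 1
      then show ?thesis by (simp add: g'2 r0)
    next
      case 2
      then show ?thesis using anchor[of u] dist_triangle[of "g' u" "g (c v)" "g a"] rle[of u]
        by (simp add: g'2 r0)
    next
      case 3
      then show ?thesis using anchor[of v] dist_triangle[of "g (c u)" "g' v" "g a"] rle[of v]
        by (simp add: g'2 r0 dist_commute)
    next
      case 4
      then have "dist (g' u) (g' v) \<le> \<bar>\<kappa> * r u - \<kappa> * r v\<bar>"
        using dist_pre_pre[OF x(1), of "h + \<kappa> * r u" "h + \<kappa> * r v"] h0 \<kappa>r[of u] \<kappa>r[of v] by (simp add: g'1)
      also have "\<dots> = \<kappa> * \<bar>r u - r v\<bar>"
        using pos by (simp add: abs_mult flip: right_diff_distrib)
      finally show ?thesis using 4 by simp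
    qed
  qed
  \<comment> \<open>The old tour respects the new speed limit: its fastest branch is the latest one,
    and gaps decrease while \<open>p - 1 \<ge> 0\<close>.\<close>
  have slow: "w * dist (g s) (g t) \<le> \<bar>s - t\<bar>" for s t
  proof (cases n)
    case 0
    then have "hh n (g t) = 0" for t by simp
    then have "g t = \<rho>" for t using gh[of t] by simp
    then show ?thesis by simp
  next
    case (Suc m)
    have "w \<le> gap m powr (p - 1)"
      unfolding w_def using p Suc by (intro powr_mono2 gap_nonneg gap_antimono) auto
    then have "w * dist (g s) (g t) \<le> gap m powr (p - 1) * dist (g s) (g t)"
      by (intro mult_right_mono) auto
    also have "\<dots> \<le> \<bar>s - t\<bar>"
      using gl[of m s t] gT gh Suc by (simp add: proj_eq_self)
    finally show ?thesis .
  qed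
  have lip: "gap K powr (p - 1) * dist (proj (Suc K) (g' u)) (proj (Suc K) (g' v)) \<le> \<bar>u - v\<bar>"
    if "K < Suc n" for K u v
  proof (cases "K = n")
    case True
    have "w * dist (g' u) (g' v) \<le> w * dist (g (c u)) (g (c v)) + (w * \<kappa>) * \<bar>r u - r v\<bar>"
      using mult_left_mono[OF step[of u v] pos(3)] by (simp add: algebra_simps)
    also have "\<dots> \<le> \<bar>c u - c v\<bar> + 1 * \<bar>r u - r v\<bar>"
      using w\<kappa> by (intro add_mono slow mult_right_mono) auto
    finally show ?thesis
      using contract[of u v] True g'T g'hh by (simp add: proj_eq_self w_def)
  next
    case False
    then have K: "K < n" "Suc K \<le> n" using that by auto
    \<comment> \<open>Projected to an older subtree the excursion stands still, so only the clock
      moves.\<close>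
    have "proj (Suc K) (g' t) = proj (Suc K) (g (c t))" for t
      using proj_proj[OF g'T K(2), of t] g'proj by simp
    then have "gap K powr (p - 1) * dist (proj (Suc K) (g' u)) (proj (Suc K) (g' v)) \<le> \<bar>c u - c v\<bar>"
      using gl[OF K(1)] by simp
    then show ?thesis using contract[of u v] by simp
  qed
  have surj: "\<exists>t\<in>{0..\<tau> + 2 * \<sigma>}. g' t = z" if z: "z \<in> T" "hh (Suc n) z = dist \<rho> z" for z
  proof (cases "hh n z = dist \<rho> z")
    case True
    then obtain t where t: "t \<in> {0..\<tau>}" "g t = z" using gs z by blast
    show ?thesis
    proof (cases "t < a")
      case True
      then have "c t = t" using pos by (auto simp: c_def)
      then show ?thesis using t True pos by (intro bexI[of _ t]) (auto simp: g'2)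
    next
      case False
      \<comment> \<open>Visits after time \<open>a\<close> are delayed by the length
        \<open>2 * \<sigma>\<close> of the excursion; a visit at \<open>a\<close> keeps its
        time.\<close>
      define t' where "t' = (if t = a then a else t + 2 * \<sigma>)"
      have t': "t' \<in> {0..\<tau> + 2 * \<sigma>}" "c t' = t" "t = a \<Longrightarrow> r t' = 0"
        using t False pos by (auto simp: t'_def c_def r_def)
      have "g' t' = z" using t' t a by (cases "t = a") (auto simp: g'1 g'2)
      then show ?thesis using t' by blast
    qed
  next
    case False
    then have lt: "hh n z < dist \<rho> z" using hh_le[of n z] by simp
    have "gromov \<rho> z x = dist \<rho> z" using z lt by (auto simp: hh_Suc x_def max_def split: if_splits)
    then have zx: "z = pre x (dist \<rho> z)" "dist \<rho> z \<le> dist \<rho> x"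
      using pre_eqI[OF z(1) x(1), of "dist \<rho> z"] pre_self[OF z(1), of "dist \<rho> z"] gromov_le(2)[of \<rho> z x] by auto
    have "hh n z = min (dist \<rho> z) h"
      using hh_pre[OF x(1), of "dist \<rho> z" n] zx(1) by (simp add: h_def)
    then have hz: "h < dist \<rho> z" using lt by auto
    have gp: "0 < gap n" using hz zx(2) x(2) by simp
    then have \<kappa>p: "0 < \<kappa>" by (simp add: \<kappa>_def)
    \<comment> \<open>The ascent along the branch reaches the height of \<open>z\<close> after time
      \<open>d\<close>.\<close>
    define d where "d = (dist \<rho> z - h) / \<kappa>"
    have "dist \<rho> z - h \<le> \<kappa> * \<sigma>" using zx(2) x(2) \<kappa>\<sigma> by simp
    then have d: "0 \<le> d" "d \<le> \<sigma>" "\<kappa> * d = dist \<rho> z - h"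
      using \<kappa>p hz by (auto simp: d_def field_simps)
    then have "c (a + d) = a" "r (a + d) = d" by (auto simp: c_def r_def)
    then have "g' (a + d) = z" using d(3) zx(1) by (simp add: g'1)
    then show ?thesis using a d by (intro bexI[of _ "a + d"]) auto
  qed
  have "(\<Sum>i<Suc n. 2 * gap i powr p) = \<tau> + 2 * \<sigma>" by (simp add: \<tau>_def \<sigma>_def)
  then have "tour p (Suc n) g'"
    unfolding tour_def using g'T g'hh contour lip surj by auto
  then show ?thesis by blast
qed

lemma tour_exists: "1 \<le> p \<Longrightarrow> \<exists>g. tour p n g"
  by (induction n) (use tour_0 tour_Suc in blast)+

text \<open>Compare at the scale \<open>K\<close> at which the gaps drop below a quarter of the distance: projecting
  to that subtree keeps half of the distance, and all its branches are explored slowly.\<close>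

lemma tour_holder:
  assumes g: "tour p n g" and p: "1 \<le> p"
  shows "(dist (g u) (g v) / 4) powr p \<le> \<bar>u - v\<bar>"
proof -
  define D where "D = dist (g u) (g v)"
  have gT: "g t \<in> T" and gh: "hh n (g t) = dist \<rho> (g t)" for t
    using g by (auto simp: tour_def)
  show ?thesis
  proof (cases "D = 0")
    case False
    then have D: "0 < D" by (simp add: D_def)
    have top: "dist (proj n (g u)) (proj n (g v)) = D"
      using gT gh by (simp add: proj_eq_self D_def)
    \<comment> \<open>The alternative \<open>k = n\<close> guarantees a witness; if it is taken,
      projecting changes nothing, because the tour stays in the \<open>n\<close>-th subtree.\<close>
    define K where "K = (LEAST k. k = n \<or> gap k \<le> D / 4)"
    have K: "K = n \<or> gap K \<le> D / 4" unfolding K_def by (rule LeastI[of _ n]) simp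
    have "K \<le> n" unfolding K_def by (rule Least_le) simp
    have half: "D / 2 \<le> dist (proj K (g u)) (proj K (g v))"
      using K top D proj_dist_le[OF gT gT, of u v K] by (auto simp: D_def)
    \<comment> \<open>\<open>proj 0\<close> is constant, so \<open>K\<close> has a predecessor
      \<open>k\<close>, whose gap still exceeds \<open>D / 4\<close>. The speed clause for
      \<open>k\<close> concerns \<open>proj (Suc k)\<close>, which is \<open>proj K\<close>: this
      shift by one lets the large gap bound the speed at the scale where half of the distance
      survives.\<close>
    have "K \<noteq> 0"
    proof
      assume "K = 0"
      then have "proj K (g u) = proj K (g v)"
        using gT by (simp add: proj_def pre_eqI gromov_nonneg)
      then show False using half D by simp
    qed
    then obtain k where k: "K = Suc k" by (cases K) auto
    then have "\<not> (k = n \<or> gap k \<le> D / 4)"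
      using not_less_Least[of k "\<lambda>k. k = n \<or> gap k \<le> D / 4"] by (simp add: K_def)
    then have gk: "D / 4 \<le> gap k" by simp
    have "(D / 4) powr p = (D / 4) powr (p - 1) * (D / 4)"
      using D powr_add[of "D / 4" "p - 1" 1] by simp
    also have "\<dots> \<le> gap k powr (p - 1) * dist (proj K (g u)) (proj K (g v))"
      using gk half D p by (intro mult_mono powr_mono2) auto
    also have "\<dots> \<le> \<bar>u - v\<bar>"
      using g \<open>K \<le> n\<close> k by (auto simp: tour_def)
    finally show ?thesis by (simp add: D_def)
  qed (simp add: D_def)
qed

end

section \<open>Cluster points in the topology of pointwise convergence\<close>

text \<open>A cluster point of the image filter is made a limit by intersecting \<open>F\<close>
  with the pullback of its neighbourhoods. Filters replace subsequences because a product over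
  uncountably many times need not be sequentially compact.\<close>

lemma compact_subfilter:
  fixes f :: "'i \<Rightarrow> 'b::topological_space"
  assumes F: "F \<noteq> bot" and K: "compact K" and ev: "eventually (\<lambda>i. f i \<in> K) F"
  obtains x F' where "x \<in> K" "F' \<le> F" "F' \<noteq> bot" "(f \<longlongrightarrow> x) F'"
proof -
  have "filtermap f F \<noteq> bot" using F by (simp add: filtermap_bot_iff)
  moreover have "eventually (\<lambda>y. y \<in> K) (filtermap f F)" using ev by (simp add: eventually_filtermap)
  ultimately obtain x where x: "x \<in> K" and cl: "inf (nhds x) (filtermap f F) \<noteq> bot"
    using K unfolding compact_filter by blast
  define F' where "F' = inf (filtercomap f (nhds x)) F"
  have "F' \<noteq> bot"
  proof
    assume "F' = bot"
    then have "eventually (\<lambda>_. False) F'" by simp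
    then obtain Q R where Q: "eventually Q (filtercomap f (nhds x))" and R: "eventually R F"
      and QR: "\<And>i. Q i \<Longrightarrow> R i \<Longrightarrow> False"
      unfolding F'_def eventually_inf by blast
    from Q obtain P where P: "eventually P (nhds x)" "\<And>i. P (f i) \<Longrightarrow> Q i"
      unfolding eventually_filtercomap by blast
    have "eventually (\<lambda>y. \<not> P y) (filtermap f F)"
      unfolding eventually_filtermap using R by eventually_elim (use P QR in blast)
    with P(1) have "eventually (\<lambda>_. False) (inf (nhds x) (filtermap f F))"
      unfolding eventually_inf by blast
    with cl show False by simp
  qed
  moreover have "(f \<longlongrightarrow> x) F'"
    unfolding F'_def by (rule tendsto_mono[OF inf_le1 filterlim_filtercomap])
  ultimately show ?thesis using that[of x F'] x by (simp add: F'_def)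
qed

text \<open>Tychonoff's theorem for a constant family.\<close>

lemma compact_functions:
  fixes T :: "'a::topological_space set"
  assumes "compact T"
  shows "compact {k :: 'b \<Rightarrow> 'a. \<forall>t. k t \<in> T}"
proof -
  have "compactin (product_topology (\<lambda>_::'b. euclidean) UNIV) (PiE UNIV (\<lambda>_. T))"
    using assms by (simp add: compactin_PiE)
  moreover have "PiE UNIV (\<lambda>_. T) = {k :: 'b \<Rightarrow> 'a. \<forall>t. k t \<in> T}" by auto
  ultimately show ?thesis by (simp add: euclidean_product_topology)
qed

lemma tendsto_apply:
  fixes h :: "'b \<Rightarrow> 'a::topological_space"
  assumes "(g \<longlongrightarrow> h) F"
  shows "((\<lambda>n. g n t) \<longlongrightarrow> h t) F"
proof (rule topological_tendstoI)
  fix S assume S: "open S" "h t \<in> S"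
  have "continuous_on UNIV (\<lambda>k :: 'b \<Rightarrow> 'a. k t)"
    by (rule continuous_on_product_then_coordinatewise) simp
  then have "open ((\<lambda>k. k t) -` S)" using S(1) by (rule open_vimage[rotated])
  from topological_tendstoD[OF assms this] show "\<forall>\<^sub>F n in F. g n t \<in> S" using S(2) by simp
qed

context rooted_tree begin

lemma tour_dist_le:
  assumes "tour p n g" "1 \<le> p"
  shows "dist (g u) (g v) \<le> 4 * \<bar>u - v\<bar> powr (1 / p)"
proof -
  have "dist (g u) (g v) / 4 = ((dist (g u) (g v) / 4) powr p) powr (1 / p)"
    using assms(2) by (simp add: powr_powr)
  also have "\<dots> \<le> \<bar>u - v\<bar> powr (1 / p)"
    using assms tour_holder[OF assms] by (intro powr_mono2) auto
  finally show ?thesis by simp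
qed

text \<open>The contour inequality and the Hoelder bound are closed conditions on finitely many
  values, so they pass to a pointwise limit. Surjectivity is not of this kind; it is recovered from
  the Hoelder bound, which is uniform in \<open>n\<close> and so controls the tours along converging
  times.\<close>

lemma contour_exploration:
  assumes p: "1 \<le> p" and summ: "summable (\<lambda>n. gap n powr p)" and gap0: "gap \<longlonglongrightarrow> 0"
  obtains g where "\<And>t. g t \<in> T"
    "\<And>s u t. s \<le> u \<Longrightarrow> u \<le> t \<Longrightarrow> gromov \<rho> (g s) (g t) \<le> dist \<rho> (g u)"
    "\<And>u v. dist (g u) (g v) \<le> 4 * \<bar>u - v\<bar> powr (1 / p)"
    "\<And>z. z \<in> T \<Longrightarrow> \<exists>t\<in>{0..\<Sum>n. 2 * gap n powr p}. g t = z"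
proof -
  obtain G where G: "\<And>n. tour p n (G n)" using tour_exists[OF p] by metis
  have GT: "G n t \<in> T" for n t using G[of n] by (auto simp: tour_def)
  obtain g F where g: "g \<in> {k. \<forall>t. k t \<in> T}" and F: "F \<le> sequentially" "F \<noteq> bot" and lim: "(G \<longlongrightarrow> g) F"
    by (rule compact_subfilter[OF _ compact_functions[OF compact], of sequentially G]) (use GT in auto)
  note limt = tendsto_apply[OF lim]
  have holder: "dist (g u) (g v) \<le> 4 * \<bar>u - v\<bar> powr (1 / p)" for u v
    by (rule tendsto_upperbound[OF tendsto_dist[OF limt limt] _ F(2)])
      (simp add: tour_dist_le[OF G p])
  show ?thesis
  proof (rule that)
    show "g t \<in> T" for t using g by auto
    show "gromov \<rho> (g s) (g t) \<le> dist \<rho> (g u)" if "s \<le> u" "u \<le> t" for s u t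
    proof (rule tendsto_le[OF F(2)])
      show "((\<lambda>n. dist \<rho> (G n u)) \<longlongrightarrow> dist \<rho> (g u)) F" by (intro tendsto_intros limt)
      show "((\<lambda>n. gromov \<rho> (G n s) (G n t)) \<longlongrightarrow> gromov \<rho> (g s) (g t)) F"
        by (intro tendsto_intros limt)
      show "\<forall>\<^sub>F n in F. gromov \<rho> (G n s) (G n t) \<le> dist \<rho> (G n u)"
        using G that unfolding tour_def by (auto intro!: always_eventually)
    qed
    show "\<exists>t\<in>{0..\<Sum>n. 2 * gap n powr p}. g t = z" if z: "z \<in> T" for z
    proof -
      let ?\<tau> = "\<Sum>n. 2 * gap n powr p"
      have "\<exists>t\<in>{0..?\<tau>}. G n t = proj n z" for n
      proof -
        have "hh n (proj n z) = dist \<rho> (proj n z)" using z by (simp add: hh_proj height_proj)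
        then obtain t where t: "t \<in> {0..\<Sum>i<n. 2 * gap i powr p}" "G n t = proj n z"
          using G[of n] proj_in[OF z] unfolding tour_def by blast
        have "(\<Sum>i<n. 2 * gap i powr p) \<le> ?\<tau>"
          by (rule sum_le_suminf) (use summ in \<open>auto intro: summable_mult\<close>)
        with t show ?thesis by (intro bexI[of _ t]) auto
      qed
      then obtain \<theta> where \<theta>: "\<And>n. \<theta> n \<in> {0..?\<tau>}" "\<And>n. G n (\<theta> n) = proj n z" by metis
      \<comment> \<open>A second refinement makes the visiting times of \<open>proj n z\<close>
        converge. Then \<open>z\<close>, \<open>G n (\<theta> n)\<close>, \<open>G n t\<close> and
        \<open>g t\<close> form a chain whose steps all tend to 0.\<close>
      obtain t F' where t: "t \<in> {0..?\<tau>}" and F': "F' \<le> F" "F' \<noteq> bot" and \<theta>t: "(\<theta> \<longlongrightarrow> t) F'"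
        by (rule compact_subfilter[OF F(2) compact_Icc[of 0 ?\<tau>], of \<theta>]) (use \<theta> in auto)
      have "((\<lambda>n. gap n + (4 * \<bar>\<theta> n - t\<bar> powr (1 / p) + dist (G n t) (g t))) \<longlongrightarrow> 0 + (4 * \<bar>t - t\<bar> powr (1 / p) + dist (g t) (g t))) F'"
      proof (intro tendsto_add tendsto_mult tendsto_dist tendsto_const)
        show "(gap \<longlongrightarrow> 0) F'" using gap0 F(1) F'(1) by (meson order_trans tendsto_mono)
        show "((\<lambda>n. G n t) \<longlongrightarrow> g t) F'" using limt F'(1) by (rule tendsto_mono[rotated])
        show "((\<lambda>n. \<bar>\<theta> n - t\<bar> powr (1 / p)) \<longlongrightarrow> \<bar>t - t\<bar> powr (1 / p)) F'"
          using p by (intro tendsto_powr' tendsto_intros \<theta>t) auto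
      qed
      moreover have "dist z (g t) \<le> gap n + (4 * \<bar>\<theta> n - t\<bar> powr (1 / p) + dist (G n t) (g t))" for n
        using dist_proj[OF z, of n] \<theta>(2)[of n] tour_dist_le[OF G p, of n "\<theta> n" t]
          dist_triangle[of z "g t" "G n (\<theta> n)"] dist_triangle[of "G n (\<theta> n)" "g t" "G n t"]
        by (simp add: dist_commute)
      ultimately have "dist z (g t) \<le> 0 + (4 * \<bar>t - t\<bar> powr (1 / p) + dist (g t) (g t))"
        by (intro tendsto_lowerbound[OF _ _ F'(2)]) auto
      then show ?thesis using t p by auto
    qed
  qed (use holder in auto)
qed

end

section \<open>The tree coded by a contour function\<close>

context rooted_tree begin

text \<open>A chain of small steps from \<open>g s\<close> to \<open>g t\<close> stays above height \<open>inf f - \<epsilon>\<close>, and by the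
  ultrametric inequality the errors along the chain do not add up.\<close>

lemma contour_attains_meet:
  fixes g :: "real \<Rightarrow> 'a"
  assumes cont: "continuous_on {s..t} g" and gT: "g ` {s..t} \<subseteq> T" and st: "s \<le> t"
    and contour: "\<And>u. s \<le> u \<Longrightarrow> u \<le> t \<Longrightarrow> gromov \<rho> (g s) (g t) \<le> dist \<rho> (g u)"
  shows "\<exists>u\<in>{s..t}. dist \<rho> (g u) = gromov \<rho> (g s) (g t)"
proof -
  obtain u where u: "u \<in> {s..t}" and umin: "\<And>v. v \<in> {s..t} \<Longrightarrow> dist \<rho> (g u) \<le> dist \<rho> (g v)"
  proof -
    have "continuous_on {s..t} (\<lambda>v. dist \<rho> (g v))" by (intro continuous_intros cont)
    moreover have "{s..t} \<noteq> {}" using st by simp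
    ultimately show ?thesis
      using that continuous_attains_inf[of "{s..t}" "\<lambda>v. dist \<rho> (g v)"] by blast
  qed
  have close: "dist \<rho> (g u) - \<epsilon> \<le> gromov \<rho> (g s) (g t)" if "0 < \<epsilon>" for \<epsilon>
  proof -
    define R where "R = (\<lambda>v w. v \<in> {s..t} \<and> w \<in> {s..t} \<and> dist \<rho> (g u) - \<epsilon> \<le> gromov \<rho> (g v) (g w))"
    have "R s t"
    \<comment> \<open>On a connected set, a symmetric and transitive relation that holds locally
      holds globally.\<close>
    proof (rule connected_equivalence_relation[of "{s..t}"])
      show "R w v" if "R v w" for v w using that by (auto simp: R_def gromov_commute)
      show "R v w" if vw: "R v x" "R x w" for v x w
      proof -
        have "min (gromov \<rho> (g v) (g x)) (gromov \<rho> (g x) (g w)) \<le> gromov \<rho> (g v) (g w)"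
          using vw gT by (intro ultrametric) (auto simp: R_def)
        then show ?thesis using vw by (auto simp: R_def)
      qed
      show "\<exists>U. openin (top_of_set {s..t}) U \<and> a \<in> U \<and> (\<forall>x\<in>U. R a x)" if a: "a \<in> {s..t}" for a
      proof -
        \<comment> \<open>The radius is \<open>2 * \<epsilon>\<close> because a meet lies half the
          distance below the mean of the two heights, each of which is at least
          \<open>dist \<rho> (g u)\<close>.\<close>
        define U where "U = {s..t} \<inter> g -` ball (g a) (2 * \<epsilon>)"
        have "openin (top_of_set {s..t}) U"
          unfolding U_def using cont by (rule continuous_openin_preimage_gen) simp
        moreover have "R a x" if "x \<in> U" for x
          using that a umin[of a] umin[of x] dist_gromov[of "g a" "g x" \<rho>]
          by (auto simp: U_def R_def)
        ultimately show ?thesis using a \<open>0 < \<epsilon>\<close> by (intro exI[of _ U]) (auto simp: U_def)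
      qed
    qed (use st in auto)
    then show ?thesis by (simp add: R_def)
  qed
  have "dist \<rho> (g u) \<le> gromov \<rho> (g s) (g t)"
  proof (rule field_le_epsilon)
    fix e :: real assume "0 < e"
    then show "dist \<rho> (g u) \<le> gromov \<rho> (g s) (g t) + e" using close[of e] by linarith
  qed
  then have "dist \<rho> (g u) = gromov \<rho> (g s) (g t)" using contour[of u] u by simp
  then show ?thesis using u by blast
qed

context
  fixes g :: "real \<Rightarrow> 'a"
  assumes cont: "continuous_on {0..1} g" and img: "g ` {0..1} = T"
    and contour: "\<And>s u t. 0 \<le> s \<Longrightarrow> s \<le> u \<Longrightarrow> u \<le> t \<Longrightarrow> t \<le> 1 \<Longrightarrow> gromov \<rho> (g s) (g t) \<le> dist \<rho> (g u)"
begin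

lemma contour_meet_segment:
  assumes st: "s \<in> {0..1}" "t \<in> {0..1}"
  shows "\<forall>u\<in>closed_segment s t. gromov \<rho> (g s) (g t) \<le> dist \<rho> (g u)"
    and "\<exists>u\<in>closed_segment s t. dist \<rho> (g u) = gromov \<rho> (g s) (g t)"
proof -
  have le: "(\<forall>u\<in>{s..t}. gromov \<rho> (g s) (g t) \<le> dist \<rho> (g u)) \<and>
      (\<exists>u\<in>{s..t}. dist \<rho> (g u) = gromov \<rho> (g s) (g t))"
    if "0 \<le> s" "s \<le> t" "t \<le> 1" for s t
  proof -
    have "{s..t} \<subseteq> {0..1}" using that by auto
    then have "continuous_on {s..t} g" "g ` {s..t} \<subseteq> T"
      using cont continuous_on_subset img by blast+
    then show ?thesis using contour_attains_meet[of s t g] contour that by auto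
  qed
  show "\<forall>u\<in>closed_segment s t. gromov \<rho> (g s) (g t) \<le> dist \<rho> (g u)"
    "\<exists>u\<in>closed_segment s t. dist \<rho> (g u) = gromov \<rho> (g s) (g t)"
    using le[of s t] le[of t s] st gromov_commute[of \<rho> "g s" "g t"]
    by (auto simp: closed_segment_eq_real_ivl)
qed

text \<open>Along the straight path the infimum is the meet. By connectedness any other path covers
  the segment between \<open>s\<close> and \<open>t\<close>, so it passes a point where the meet is
  attained; the supremum is therefore a maximum.\<close>

lemma tree_pdist_contour:
  assumes st: "s \<in> {0..1}" "t \<in> {0..1}"
  shows "tree_pdist (\<lambda>t. dist \<rho> (g t)) s t = dist (g s) (g t)"
proof -
  let ?f = "\<lambda>t. dist \<rho> (g t)" and ?m = "gromov \<rho> (g s) (g t)"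
  let ?P = "{\<gamma>. path \<gamma> \<and> path_image \<gamma> \<subseteq> {0..1} \<and> pathstart \<gamma> = s \<and> pathfinish \<gamma> = t}"
  obtain u where u: "u \<in> closed_segment s t" "?f u = ?m" using contour_meet_segment(2)[OF st] by auto
  have line: "linepath s t \<in> ?P"
    using st by (auto simp: closed_segment_eq_real_ivl split: if_splits)
  have "(INF r\<in>{0..1}. ?f (linepath s t r)) = ?m"
  proof (rule cInf_eq_minimum)
    have im: "linepath s t ` {0..1} = closed_segment s t"
      using path_image_linepath[of s t] by (simp add: path_image_def)
    then have "u \<in> linepath s t ` {0..1}" using u by simp
    then show "?m \<in> (\<lambda>r. ?f (linepath s t r)) ` {0..1}" using u by force
    fix x assume "x \<in> (\<lambda>r. ?f (linepath s t r)) ` {0..1}"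
    then obtain r where "r \<in> {0..1}" "x = ?f (linepath s t r)" by auto
    moreover from this have "linepath s t r \<in> closed_segment s t" using im by blast
    ultimately show "?m \<le> x" using contour_meet_segment(1)[OF st] by auto
  qed
  moreover have "(INF r\<in>{0..1}. ?f (\<gamma> r)) \<le> ?m" if "\<gamma> \<in> ?P" for \<gamma>
  proof -
    have "connected (path_image \<gamma>)" using that by (auto intro: connected_path_image)
    then have "convex (path_image \<gamma>)" by (metis is_interval_connected_1 is_interval_convex_1)
    moreover have "s \<in> path_image \<gamma>" "t \<in> path_image \<gamma>"
      using that pathstart_in_path_image[of \<gamma>] pathfinish_in_path_image[of \<gamma>] by auto
    ultimately have "closed_segment s t \<subseteq> path_image \<gamma>" by (rule closed_segment_subset[rotated 2])
    then obtain r where "r \<in> {0..1}" "\<gamma> r = u" using u by (auto simp: path_image_def)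
    moreover have "bdd_below ((\<lambda>r. ?f (\<gamma> r)) ` {0..1})" by (rule bdd_belowI2[of _ 0]) simp
    ultimately show ?thesis using u cINF_lower[of "\<lambda>r. ?f (\<gamma> r)" "{0..1}" r] by simp
  qed
  ultimately have "(SUP \<gamma>\<in>?P. INF r\<in>{0..1}. ?f (\<gamma> r)) = ?m"
    using line by (intro cSup_eq_maximum) (auto intro!: image_eqI[of _ _ "linepath s t"])
  then show ?thesis
    using dist_gromov[of "g s" "g t" \<rho>] unfolding tree_pdist_def by simp
qed

text \<open>\<open>h\<close> sends a point to the set of times at which \<open>g\<close> visits it.
  Since the pseudo-distance of two times is the distance of the points visited, these sets are
  exactly the classes of \<open>tree_rel\<close>.\<close>

lemma isometric_to_tree_of_contour: "isometric_to_tree_of T (\<lambda>t. dist \<rho> (g t))"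
proof -
  let ?f = "\<lambda>t. dist \<rho> (g t)"
  define h where "h = (\<lambda>x. {t \<in> {0..1}. g t = x})"
  have cls: "tree_rel ?f `` {s} = h (g s)" if "s \<in> {0..1}" for s
    using that tree_pdist_contour by (auto simp: tree_rel_def h_def)
  have "tree_of ?f = (\<lambda>s. h (g s)) ` {0..1}"
    unfolding tree_of_def quotient_def using cls by auto
  also have "\<dots> = h ` T" using img by (auto simp: image_image[symmetric])
  finally have im: "h ` T = tree_of ?f" by simp
  have ne: "\<exists>t. t \<in> {0..1} \<and> g t = x" if "x \<in> T" for x using that img by auto
  have "inj_on h T"
  proof (rule inj_onI)
    fix x y assume xy: "x \<in> T" "y \<in> T" "h x = h y"
    obtain t where "t \<in> h x" using ne[OF xy(1)] by (auto simp: h_def)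
    moreover from this have "t \<in> h y" using xy by simp
    ultimately show "x = y" by (simp add: h_def)
  qed
  moreover have "tree_dist ?f (h x) (h y) = dist x y" if xy: "x \<in> T" "y \<in> T" for x y
  proof -
    have "\<exists>a. a \<in> h x" "\<exists>b. b \<in> h y" using ne[OF xy(1)] ne[OF xy(2)] by (auto simp: h_def)
    then obtain a b where ab: "a \<in> h x" "b \<in> h y" by blast
    have pd: "tree_pdist ?f s t = dist x y" if "s \<in> h x" "t \<in> h y" for s t
      using that tree_pdist_contour[of s t] by (auto simp: h_def)
    \<comment> \<open>\<open>the_elem\<close> needs a singleton: the value is the same for all
      representatives, and the classes are nonempty.\<close>
    have "(\<Union>s\<in>h x. \<Union>t\<in>h y. {tree_pdist ?f s t}) = {dist x y}"
    proof
      show "(\<Union>s\<in>h x. \<Union>t\<in>h y. {tree_pdist ?f s t}) \<subseteq> {dist x y}"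
        using pd by (intro UN_least) simp
      show "{dist x y} \<subseteq> (\<Union>s\<in>h x. \<Union>t\<in>h y. {tree_pdist ?f s t})"
        using pd[OF ab] ab by blast
    qed
    then show ?thesis by (simp add: tree_dist_def)
  qed
  ultimately show ?thesis unfolding isometric_to_tree_of_def bij_betw_def using im by blast
qed

end

end

text \<open>The exponents \<open>1 / p\<close> and \<open>p\<close> cancel, so each summand is at
  most a constant times the length of its interval, and the lengths add up to 1.\<close>

lemma holder01_p_variation:
  assumes p: "0 < p" and f: "holder01 (1 / p) f"
  shows "p_variation f p < \<infinity>"
proof -
  obtain C where C: "\<And>s t. s \<in> {0..1} \<Longrightarrow> t \<in> {0..1} \<Longrightarrow> \<bar>f s - f t\<bar> \<le> C * \<bar>s - t\<bar> powr (1 / p)"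
    using f unfolding holder01_def by blast
  \<comment> \<open>The sign of \<open>C\<close> is left open by \<open>holder01\<close>; passing to
    \<open>\<bar>C\<bar>\<close> allows taking powers.\<close>
  have C': "\<bar>f s - f t\<bar> \<le> \<bar>C\<bar> * \<bar>s - t\<bar> powr (1 / p)" if "s \<in> {0..1}" "t \<in> {0..1}" for s t
    by (rule order_trans[OF C[OF that] mult_right_mono[OF abs_ge_self powr_ge_zero]])
  have "p_variation_sum f p \<le> ennreal (\<bar>C\<bar> powr p)"
    unfolding p_variation_sum_def
  proof (rule SUP_least)
    fix D :: "nat \<times> (nat \<Rightarrow> real)" assume D: "D \<in> partitions01"
    obtain n t where nt: "D = (n, t)" by (cases D)
    then have t: "t 0 = 0" "t n = 1" and inc: "\<And>k. k < n \<Longrightarrow> t k < t (Suc k)"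
      using D by (auto simp: partitions01_def)
    have mono: "t i \<le> t j" if "i \<le> j" "j \<le> n" for i j
      using that
    proof (induction j rule: dec_induct)
      case (step m)
      then show ?case using inc[of m] by simp
    qed simp
    have bound: "\<bar>f (t (Suc k)) - f (t k)\<bar> powr p \<le> \<bar>C\<bar> powr p * (t (Suc k) - t k)" if "k < n" for k
    proof -
      have "t (Suc k) \<in> {0..1}" "t k \<in> {0..1}"
        using mono[of 0 k] mono[of 0 "Suc k"] mono[of k n] mono[of "Suc k" n] t that by auto
      then have "\<bar>f (t (Suc k)) - f (t k)\<bar> powr p \<le> (\<bar>C\<bar> * \<bar>t (Suc k) - t k\<bar> powr (1 / p)) powr p"
        using C' p by (intro powr_mono2) auto
      also have "\<dots> = \<bar>C\<bar> powr p * (t (Suc k) - t k)"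
        using p inc[OF that] by (simp add: powr_mult powr_powr)
      finally show ?thesis .
    qed
    have "(\<Sum>k<n. \<bar>f (t (Suc k)) - f (t k)\<bar> powr p) \<le> (\<Sum>k<n. \<bar>C\<bar> powr p * (t (Suc k) - t k))"
      using bound by (intro sum_mono) auto
    also have "\<dots> = \<bar>C\<bar> powr p"
      using t sum_lessThan_telescope[of t n] by (simp flip: sum_distrib_left)
    finally show "(case D of (n, t) \<Rightarrow> ennreal (\<Sum>k<n. \<bar>f (t (Suc k)) - f (t k)\<bar> powr p)) \<le> ennreal (\<bar>C\<bar> powr p)"
      unfolding nt prod.case by (rule ennreal_leI)
  qed
  then have "p_variation_sum f p \<noteq> \<infinity>" by (auto simp: top_unique)
  then show ?thesis by (simp add: p_variation_def)
qed

section \<open>Box dimension\<close>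

text \<open>A ball of radius \<open>r\<close> contains at most one point of \<open>A\<close>, so
  assigning to each point the centre of a ball containing it is injective.\<close>

lemma separated_card_le_covering_number:
  assumes T: "compact T" and r: "0 < r" and A: "A \<subseteq> T"
    and sep: "\<And>x y. x \<in> A \<Longrightarrow> y \<in> A \<Longrightarrow> x \<noteq> y \<Longrightarrow> 2 * r \<le> dist x y"
  shows "card A \<le> covering_number T r"
proof -
  \<comment> \<open>A finite cover has to exist for \<open>LEAST\<close> to be attained.\<close>
  have "\<exists>n C. finite C \<and> C \<subseteq> T \<and> card C = n \<and> T \<subseteq> (\<Union>x\<in>C. ball x r)"
    using seq_compact_imp_totally_bounded[of T] T r by (auto simp: compact_eq_seq_compact_metric)
  from LeastI_ex[OF this] obtain C where
    C: "finite C" "card C = covering_number T r" "T \<subseteq> (\<Union>x\<in>C. ball x r)"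
    unfolding covering_number_def by blast
  have "\<exists>c\<in>C. x \<in> ball c r" if "x \<in> A" for x using that A C(3) by blast
  then obtain c where c: "\<And>x. x \<in> A \<Longrightarrow> c x \<in> C" "\<And>x. x \<in> A \<Longrightarrow> dist (c x) x < r"
    by (metis mem_ball)
  have "inj_on c A"
  proof (rule inj_onI, rule ccontr)
    fix x y assume xy: "x \<in> A" "y \<in> A" "c x = c y" "x \<noteq> y"
    have "dist x y \<le> dist (c x) x + dist (c x) y" by (rule dist_triangle3)
    also have "\<dots> < 2 * r" using c(2)[OF xy(1)] c(2)[OF xy(2)] xy(3) by simp
    finally show False using sep[of x y] xy by simp
  qed
  then have "card A \<le> card C" using c(1) C(1) by (intro card_inj_on_le) auto
  then show ?thesis using C(2) by simp
qed

lemma covering_number_le_powr: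
  assumes "upper_box_dim T < ereal d"
  shows "\<forall>\<^sub>F \<epsilon> in at_right 0. real (covering_number T \<epsilon>) \<le> (1 / \<epsilon>) powr d"
proof -
  have "Limsup (at_right 0) (\<lambda>\<epsilon>. ereal (ln (real (covering_number T \<epsilon>)) / ln (1 / \<epsilon>))) < ereal d"
    using assms by (auto simp: upper_box_dim_def split: if_splits)
  then have ev: "\<forall>\<^sub>F \<epsilon> in at_right 0. ereal (ln (real (covering_number T \<epsilon>)) / ln (1 / \<epsilon>)) < ereal d"
    by (rule Limsup_lessD)
  have small: "\<forall>\<^sub>F \<epsilon> in at_right (0::real). 0 < \<epsilon> \<and> \<epsilon> < 1"
    by (rule eventually_mono[OF eventually_at_right_real[of 0 1]]) auto
  show ?thesis using ev small
  proof eventually_elim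
    case (elim \<epsilon>)
    have "0 < ln (1 / \<epsilon>)" using elim by (simp add: ln_div)
    then have le: "ln (real (covering_number T \<epsilon>)) \<le> d * ln (1 / \<epsilon>)"
      using elim by (simp add: divide_simps split: if_splits)
    \<comment> \<open>Since \<open>ln 0 = 0\<close>, the logarithmic bound says nothing about a
      covering number 0.\<close>
    show ?case
    proof (cases "covering_number T \<epsilon> = 0")
      case False
      have "real (covering_number T \<epsilon>) = exp (ln (real (covering_number T \<epsilon>)))" using False by simp
      also have "\<dots> \<le> exp (d * ln (1 / \<epsilon>))" using le by simp
      also have "\<dots> = (1 / \<epsilon>) powr d" using elim by (simp add: powr_def)
      finally show ?thesis .
    qed simp
  qed
qed

lemma upper_box_dim_nonneg: "0 \<le> upper_box_dim T"
proof (cases "totally_bounded T")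
  case True
  have "\<forall>\<^sub>F \<epsilon> in at_right (0::real). 0 < \<epsilon> \<and> \<epsilon> < 1"
    by (rule eventually_mono[OF eventually_at_right_real[of 0 1]]) auto
  then have "\<forall>\<^sub>F \<epsilon> in at_right (0::real). 0 \<le> ereal (ln (real (covering_number T \<epsilon>)) / ln (1 / \<epsilon>))"
  proof eventually_elim
    case (elim \<epsilon>)
    have "0 \<le> ln (real (covering_number T \<epsilon>))" by (cases "covering_number T \<epsilon> = 0") auto
    moreover have "0 < ln (1 / \<epsilon>)" using elim by (simp add: ln_div)
    ultimately show ?case by simp
  qed
  then have "Limsup (at_right (0::real)) (\<lambda>_. 0::ereal) \<le> upper_box_dim T"
    using True by (auto simp: upper_box_dim_def intro: Limsup_mono)
  then show ?thesis by (simp add: Limsup_const)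
qed (simp add: upper_box_dim_def)

text \<open>The constant \<open>c\<close> disappears in the limit of
  \<open>ln (c / \<epsilon>) / ln (1 / \<epsilon>)\<close>. Applied to a branch of positive length
  this yields \<open>1 \<le> p\<close>, on which the monotonicity of the speeds rests.\<close>

lemma upper_box_dim_ge_1:
  assumes c: "0 < c" and N: "\<And>\<epsilon>. 0 < \<epsilon> \<Longrightarrow> c / \<epsilon> \<le> real (covering_number T \<epsilon>)"
  shows "1 \<le> upper_box_dim T"
proof (cases "totally_bounded T")
  case True
  have "((\<lambda>\<epsilon>. ln (c / \<epsilon>) / ln (1 / \<epsilon>)) \<longlongrightarrow> 1) (at_right 0)"
    using c by real_asymp
  then have "((\<lambda>\<epsilon>. ereal (ln (c / \<epsilon>) / ln (1 / \<epsilon>))) \<longlongrightarrow> ereal 1) (at_right 0)"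
    by (simp add: tendsto_ereal)
  then have "Limsup (at_right 0) (\<lambda>\<epsilon>. ereal (ln (c / \<epsilon>) / ln (1 / \<epsilon>))) = ereal 1"
    by (intro lim_imp_Limsup) auto
  moreover have "Limsup (at_right 0) (\<lambda>\<epsilon>. ereal (ln (c / \<epsilon>) / ln (1 / \<epsilon>))) \<le> upper_box_dim T"
  proof -
    have "\<forall>\<^sub>F \<epsilon> in at_right (0::real). 0 < \<epsilon> \<and> \<epsilon> < 1"
      by (rule eventually_mono[OF eventually_at_right_real[of 0 1]]) auto
    then have "\<forall>\<^sub>F \<epsilon> in at_right 0. ereal (ln (c / \<epsilon>) / ln (1 / \<epsilon>)) \<le>
        ereal (ln (real (covering_number T \<epsilon>)) / ln (1 / \<epsilon>))"
    proof eventually_elim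
      case (elim \<epsilon>)
      have "0 < c / \<epsilon>" using c elim by simp
      then have "ln (c / \<epsilon>) \<le> ln (real (covering_number T \<epsilon>))"
        using N[of \<epsilon>] elim by (subst ln_le_cancel_iff) (auto intro: less_le_trans)
      moreover have "0 < ln (1 / \<epsilon>)" using elim by (simp add: ln_div)
      ultimately show ?case unfolding ereal_less_eq by (intro divide_right_mono) auto
    qed
    then show ?thesis using True by (auto simp: upper_box_dim_def intro: Limsup_mono)
  qed
  ultimately show ?thesis by (simp add: one_ereal_def)
qed (simp add: upper_box_dim_def)

context rooted_tree begin

text \<open>The points of the branch to \<open>x\<close> at heights
  \<open>0, 2 * r, 4 * r, ...\<close> are \<open>2 * r\<close>-separated. Counting the root there
  are \<open>Suc M\<close> of them, which makes up for rounding down.\<close>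

lemma covering_number_ge_height:
  assumes x: "x \<in> T" and r: "0 < r"
  shows "dist \<rho> x / 2 / r \<le> real (covering_number T r)"
proof -
  define M where "M = nat \<lfloor>dist \<rho> x / (2 * r)\<rfloor>"
  define y where "y = (\<lambda>j::nat. pre x (2 * r * real j))"
  have M: "real M \<le> dist \<rho> x / (2 * r)" "dist \<rho> x / (2 * r) \<le> real (Suc M)"
    using r by (auto simp: M_def) linarith+
  have height: "dist \<rho> (y j) = 2 * r * real j" if "j \<le> M" for j
  proof -
    have "real j \<le> dist \<rho> x / (2 * r)" using that M(1) by linarith
    then have "2 * r * real j \<le> dist \<rho> x" using r by (simp add: field_simps)
    then show ?thesis using x r by (simp add: y_def height_pre)
  qed
  have sep: "2 * r \<le> dist (y i) (y j)" if "i \<le> M" "j \<le> M" "i \<noteq> j" for i j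
  proof -
    have "\<bar>dist \<rho> (y i) - dist \<rho> (y j)\<bar> \<le> dist (y i) (y j)"
      by (metis abs_dist_diff_le dist_commute)
    moreover have "\<bar>dist \<rho> (y i) - dist \<rho> (y j)\<bar> = 2 * r * \<bar>real i - real j\<bar>"
      using r that by (simp add: height abs_mult flip: right_diff_distrib)
    moreover have "1 \<le> \<bar>real i - real j\<bar>" using that(3) by linarith
    then have "2 * r * 1 \<le> 2 * r * \<bar>real i - real j\<bar>" using r by (intro mult_left_mono) auto
    ultimately show ?thesis by linarith
  qed
  have "inj_on y {..M}"
    using sep r by (intro inj_onI) (metis atMost_iff dist_self not_le mult_pos_pos zero_less_numeral)
  then have "Suc M = card (y ` {..M})" by (simp add: card_image)
  also have "\<dots> \<le> covering_number T r"
    using x r sep by (intro separated_card_le_covering_number compact) (auto simp: y_def pre_in)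
  finally have "real (Suc M) \<le> real (covering_number T r)" by linarith
  then show ?thesis using M(2) by (simp add: field_simps)
qed

lemma covering_number_ge_gap:
  assumes r: "0 < r" "2 * r \<le> gap n"
  shows "Suc n \<le> covering_number T r"
proof -
  have sep: "2 * r \<le> dist (tip i) (tip j)" if "i \<le> n" "j \<le> n" "i \<noteq> j" for i j
  proof -
    have lt: "2 * r \<le> dist (tip i) (tip j)" if "i < j" "j \<le> n" for i j
      using gap_separated[OF that(1)] gap_antimono[OF that(2)] r by linarith
    show ?thesis using lt[of i j] lt[of j i] that by (cases "i < j") (auto simp: dist_commute)
  qed
  have "inj_on tip {..n}"
    using sep r by (intro inj_onI) (metis atMost_iff dist_self not_le mult_pos_pos zero_less_numeral)
  then have "Suc n = card (tip ` {..n})" by (simp add: card_image)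
  also have "\<dots> \<le> covering_number T r"
    using r sep by (intro separated_card_le_covering_number compact) (auto simp: tip_in)
  finally show ?thesis .
qed

lemma gap_tendsto_0: "gap \<longlonglongrightarrow> 0"
proof (rule tendstoI)
  fix e :: real assume e: "0 < e"
  have "dist (gap n) 0 < e" if "covering_number T (e / 2) \<le> n" for n
  proof (rule ccontr)
    assume "\<not> dist (gap n) 0 < e"
    then have "2 * (e / 2) \<le> gap n" using gap_nonneg[of n] by simp
    then show False using covering_number_ge_gap[of "e / 2" n] e that by simp
  qed
  then show "\<forall>\<^sub>F n in sequentially. dist (gap n) 0 < e"
    by (rule eventually_mono[OF eventually_ge_at_top])
qed

text \<open>At radius \<open>gap n / 2\<close> the covering number is at least \<open>n + 1\<close>
  and, once the gap is small and positive, at most \<open>(2 / gap n) powr d\<close>. Hence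
  \<open>gap n powr p\<close> is at most of order \<open>n powr (- p / d)\<close>, with exponent
  below -1 as \<open>d < p\<close>.\<close>

lemma summable_gap_powr:
  assumes dim: "upper_box_dim T < ereal d" and d: "0 < d" "d < p"
  shows "summable (\<lambda>n. gap n powr p)"
proof (rule summable_comparison_test_ev)
  have "\<forall>\<^sub>F \<epsilon> in at_right 0. real (covering_number T \<epsilon>) \<le> (1 / \<epsilon>) powr d"
    by (rule covering_number_le_powr[OF dim])
  then obtain b where b: "0 < b" "\<And>\<epsilon>. 0 < \<epsilon> \<Longrightarrow> \<epsilon> < b \<Longrightarrow> real (covering_number T \<epsilon>) \<le> (1 / \<epsilon>) powr d"
    unfolding eventually_at_right_field by auto
  have "\<forall>\<^sub>F n in sequentially. gap n < b"
    using order_tendstoD(2)[OF gap_tendsto_0 b(1)] .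
  then show "\<forall>\<^sub>F n in sequentially. norm (gap n powr p) \<le> 2 powr p * real (Suc n) powr (- p / d)"
  proof eventually_elim
    case (elim n)
    show ?case
    proof (cases "gap n = 0")
      case False
      then have g: "0 < gap n" using gap_nonneg[of n] by simp
      have "real (Suc n) \<le> real (covering_number T (gap n / 2))"
        using covering_number_ge_gap[of "gap n / 2" n] g by simp
      also have "\<dots> \<le> (2 / gap n) powr d" using b(2)[of "gap n / 2"] g elim by simp
      finally have "real (Suc n) powr (p / d) \<le> ((2 / gap n) powr d) powr (p / d)"
        using d by (intro powr_mono2) auto
      also have "\<dots> = 2 powr p / gap n powr p"
        using d g by (simp add: powr_powr powr_divide)
      finally have "gap n powr p * real (Suc n) powr (p / d) \<le> 2 powr p"
        using g by (simp add: field_simps)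
      then have "gap n powr p \<le> 2 powr p / real (Suc n) powr (p / d)"
        by (simp add: pos_le_divide_eq)
      then show ?thesis by (simp add: powr_minus_divide)
    qed simp
  qed
  have "summable (\<lambda>n. real n powr (- p / d))"
    using d by (subst summable_real_powr_iff) (auto simp: field_simps)
  then have "summable (\<lambda>n. real (Suc n) powr (- p / d))" by (subst summable_Suc_iff)
  then show "summable (\<lambda>n. 2 powr p * real (Suc n) powr (- p / d))" by (rule summable_mult)
qed

end

section \<open>Conclusion\<close>

lemma holder_continuous_on:
  fixes g :: "real \<Rightarrow> 'a::metric_space"
  assumes "0 < \<alpha>" and holder: "\<And>s t. dist (g s) (g t) \<le> C * \<bar>s - t\<bar> powr \<alpha>"
  shows "continuous_on S g"
  unfolding continuous_on_def
proof
  fix t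
  have "((\<lambda>s. C * \<bar>s - t\<bar> powr \<alpha>) \<longlongrightarrow> C * \<bar>t - t\<bar> powr \<alpha>) (at t within S)"
    using assms(1) by (intro tendsto_mult tendsto_const tendsto_powr' tendsto_intros) auto
  then have "((\<lambda>s. C * \<bar>s - t\<bar> powr \<alpha>) \<longlongrightarrow> 0) (at t within S)" by simp
  then have "((\<lambda>s. dist (g s) (g t)) \<longlongrightarrow> 0) (at t within S)"
  proof (rule Lim_null_comparison[rotated])
    show "\<forall>\<^sub>F s in at t within S. norm (dist (g s) (g t)) \<le> C * \<bar>s - t\<bar> powr \<alpha>"
      using holder by (intro always_eventually) simp
  qed
  then show "(g \<longlongrightarrow> g t) (at t within S)" by (rule tendsto_dist_iff[THEN iffD2])
qed

text \<open>A one-point tree has dimension 0, so \<open>p\<close> may be less than 1 and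
  \<open>contour_exploration\<close> is out of reach; a constant curve serves instead. Otherwise the
  exploration is rescaled to the unit interval, which only changes the Hoelder constant.\<close>

lemma (in rooted_tree) holder_contour_exploration:
  assumes dim: "upper_box_dim T < \<infinity>" and \<delta>: "0 < \<delta>"
  defines "p \<equiv> real_of_ereal (upper_box_dim T) + \<delta>"
  obtains g :: "real \<Rightarrow> 'a" and C where "g ` {0..1} = T"
    "\<And>s u t. s \<le> u \<Longrightarrow> u \<le> t \<Longrightarrow> gromov \<rho> (g s) (g t) \<le> dist \<rho> (g u)"
    "\<And>s t. dist (g s) (g t) \<le> C * \<bar>s - t\<bar> powr (1 / p)"
proof (cases "T = {\<rho>}")
  case True
  then show ?thesis by (intro that[of "\<lambda>_. \<rho>" 0]) (auto simp: image_constant_conv)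
next
  case False
  then obtain x where x: "x \<in> T" "x \<noteq> \<rho>" using root by blast
  have dim1: "1 \<le> upper_box_dim T"
    using x covering_number_ge_height[OF x(1)] by (intro upper_box_dim_ge_1[of "dist \<rho> x / 2"]) auto
  obtain D where D: "upper_box_dim T = ereal D"
    using dim dim1 by (cases "upper_box_dim T") auto
  have p: "p = D + \<delta>" "1 \<le> D" using D dim1 by (auto simp: p_def one_ereal_def)
  have summ: "summable (\<lambda>n. gap n powr p)"
    \<comment> \<open>Half of \<open>\<delta>\<close> is spent to get strictly above the dimension,
      the other half to stay strictly below \<open>p\<close>.\<close>
    using D \<delta> p by (intro summable_gap_powr[of "D + \<delta> / 2"]) auto
  have p1: "1 \<le> p" using p \<delta> by simp
  let ?\<tau> = "\<Sum>n. 2 * gap n powr p"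
  obtain g where g: "\<And>t. g t \<in> T"
    "\<And>s u t. s \<le> u \<Longrightarrow> u \<le> t \<Longrightarrow> gromov \<rho> (g s) (g t) \<le> dist \<rho> (g u)"
    "\<And>u v. dist (g u) (g v) \<le> 4 * \<bar>u - v\<bar> powr (1 / p)"
    "\<And>z. z \<in> T \<Longrightarrow> \<exists>t\<in>{0..?\<tau>}. g t = z"
    by (rule contour_exploration[OF p1 summ gap_tendsto_0]) (rule that; assumption)
  have \<tau>: "0 \<le> ?\<tau>" using summ by (intro suminf_nonneg summable_mult) auto
  show ?thesis
  proof (rule that)
    show "(\<lambda>t. g (?\<tau> * t)) ` {0..1} = T"
    proof
      show "T \<subseteq> (\<lambda>t. g (?\<tau> * t)) ` {0..1}"
      proof
        fix z assume "z \<in> T"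
        then obtain t where t: "t \<in> {0..?\<tau>}" "g t = z" using g(4) by blast
        \<comment> \<open>If \<open>?\<tau> = 0\<close>, then \<open>t = 0\<close>, and division by
          zero returns 0 as desired.\<close>
        then have "t / ?\<tau> \<in> {0..1}" "?\<tau> * (t / ?\<tau>) = t" by (auto simp: divide_le_eq_1)
        then show "z \<in> (\<lambda>t. g (?\<tau> * t)) ` {0..1}" using t by (intro image_eqI[of _ _ "t / ?\<tau>"]) auto
      qed
    qed (use g(1) in auto)
    show "gromov \<rho> (g (?\<tau> * s)) (g (?\<tau> * t)) \<le> dist \<rho> (g (?\<tau> * u))" if "s \<le> u" "u \<le> t" for s u t
      using that \<tau> by (intro g(2) mult_left_mono)
    show "dist (g (?\<tau> * s)) (g (?\<tau> * t)) \<le> 4 * ?\<tau> powr (1 / p) * \<bar>s - t\<bar> powr (1 / p)" for s t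
      using g(3)[of "?\<tau> * s" "?\<tau> * t"] \<tau>
      by (simp add: powr_mult abs_mult mult.assoc flip: right_diff_distrib)
  qed
qed

lemma real_tree_rooted_tree:
  assumes "compact T" "real_tree T" "\<rho> \<in> T"
  shows "rooted_tree T \<rho>"
proof
  show "min (gromov \<rho> x y) (gromov \<rho> y z) \<le> gromov \<rho> x z" if "x \<in> T" "y \<in> T" "z \<in> T" for x y z
    using real_tree_gromov_ultrametric[OF assms(2,3) that] .
  show "\<exists>z\<in>T. dist \<rho> z = s \<and> dist z x = dist \<rho> x - s" if "x \<in> T" "0 \<le> s" "s \<le> dist \<rho> x" for x s
  proof -
    have "geodesic_set T" using assms(2) by (simp add: real_tree_def)
    from geodesic_set_prefix[OF this assms(3) that] show ?thesis by blast
  qed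
qed (use assms in auto)

theorem theorem2p19:
  fixes T :: "'a::metric_space set" and \<delta> :: real
  assumes "compact T"
    and "real_tree T"
    and "upper_box_dim T < \<infinity>"
    and "\<delta> > 0"
  shows "let p = real_of_ereal (upper_box_dim T) + \<delta> in
    \<exists>f :: real \<Rightarrow> real.
      continuous_on {0..1} f \<and> p_variation f p < \<infinity> \<and> isometric_to_tree_of T f \<and>
      (\<exists>\<phi>. reparametrization01 \<phi> \<and>
           continuous_on {0..1} (f \<circ> \<phi>) \<and> p_variation (f \<circ> \<phi>) p < \<infinity> \<and>
           isometric_to_tree_of T (f \<circ> \<phi>) \<and> holder01 (1 / p) (f \<circ> \<phi>))"
proof -
  obtain \<rho> where "\<rho> \<in> T" using assms(2) by (auto simp: real_tree_def)
  then interpret rooted_tree T \<rho> using real_tree_rooted_tree assms by blast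
  define p where "p = real_of_ereal (upper_box_dim T) + \<delta>"
  have p: "0 < p"
    using upper_box_dim_nonneg[of T] assms(4) by (simp add: p_def real_of_ereal_pos add_nonneg_pos)
  obtain g C where g: "g ` {0..1} = T"
    "\<And>s u t. s \<le> u \<Longrightarrow> u \<le> t \<Longrightarrow> gromov \<rho> (g s) (g t) \<le> dist \<rho> (g u)"
    "\<And>s t. dist (g s) (g t) \<le> C * \<bar>s - t\<bar> powr (1 / p)"
    using holder_contour_exploration[OF assms(3,4)] unfolding p_def by blast
  define f where "f = (\<lambda>t. dist \<rho> (g t))"
  have contg: "continuous_on {0..1} g"
    using p g(3) by (intro holder_continuous_on[of "1 / p"]) auto
  then have cont: "continuous_on {0..1} f"
    unfolding f_def by (intro continuous_intros)
  have iso: "isometric_to_tree_of T f"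
    unfolding f_def by (rule isometric_to_tree_of_contour[OF contg g(1)]) (rule g(2))
  have "\<bar>f s - f t\<bar> \<le> C * \<bar>s - t\<bar> powr (1 / p)" for s t
    using g(3)[of s t] abs_dist_diff_le[of "g s" \<rho> "g t"] by (simp add: f_def dist_commute)
  then have holder: "holder01 (1 / p) f" unfolding holder01_def by blast
  have "reparametrization01 (\<lambda>t. t)"
    by (auto simp: reparametrization01_def strict_mono_on_def)
  moreover have "f \<circ> (\<lambda>t. t) = f" by auto
  ultimately show ?thesis
    unfolding Let_def p_def[symmetric]
    using cont iso holder holder01_p_variation[OF p holder] by metis
qed

end
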